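(* Let $\mathcal{N}=(N,|\cdot|)$ and $\mathcal{N}'=(N',|\cdot|')$ be normed spaces, where $N$ and $N'$ are vector spaces over the same field, which is $\mathbb{R}$ or $\mathbb{C}$. If $\mathcal{N}$ and $\mathcal{N}'$ are both infinite-dimensional, then for every bijection $f:\mathcal{P}(N)\to\mathcal{P}(N')$ the following two conditions are equivalent: (1) $f$ is induced by a semilinear homeomorphism of $\mathcal{N}$ to $\mathcal{N}'$; (2) $f$ and $f^{-1}$ are both $\mathrm{PGL}^{c}$-mappings.
   Context: $\mathcal{P}(N)$ denotes the projective space whose points are the $1$-dimensional subspaces of the vector space $N$. $\mathrm{GL}(\mathcal{N})$ is the group of all linear automorphisms of the normed space $\mathcal{N}$, i.e. linear bijections $N\to N$ that are continuous with continuous inverse. $\mathrm{PGL}(\mathcal{N})$ is the group of all transformations of $\mathcal{P}(N)$ of the form $P\mapsto u(P)$ with $u\in\mathrm{GL}(\mathcal{N})$. A mapping $f:\mathcal{P}(N)\to\mathcal{P}(N')$ is a $\mathrm{PGL}^{c}$-mapping if for every $h\in\mathrm{PGL}(\mathcal{N})$ there is $h'\in\mathrm{PGL}(\mathcal{N}')$ such that $fh=h'f$ (and analogously for mappings $\mathcal{P}(N')\to\mathcal{P}(N)$). A mapping $l:N\to N'$ of vector spaces over a field $F$ is semilinear if it is additive and there is a homomorphism $\sigma:F\to F$ with $l(ax)=\sigma(a)l(x)$ for all $a\in F$, $x\in N$; a semilinear bijection is a semilinear isomorphism if $\sigma$ is an isomorphism. A semilinear homeomorphism of $\mathcal{N}$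 to $\mathcal{N}'$ is a semilinear isomorphism $l:N\to N'$ which is a homeomorphism for the norm topologies. The map $f$ is induced by $l$ if $f(P)=l(P)$ for every $1$-dimensional subspace $P$ of $N$. *)

theory Defs
  imports "HOL-Analysis.Analysis"
begin

text \<open>
  A normed space over \<open>'k\<close> (to be used with \<open>'k = real\<close> and \<open>'k = complex\<close>) is a scalar
  multiplication by \<open>'k\<close> on a type of class \<open>real_normed_vector\<close>; the class supplies the norm,
  its topology, and the underlying real vector space. For \<open>'k = real\<close> the locale forces
  \<open>s = scaleR\<close>.
\<close>

locale normed_space = vector_space s
  for s :: "'k::real_normed_field \<Rightarrow> 'a::real_normed_vector \<Rightarrow> 'a" +
  assumes s_of_real: "s (of_real r) x = r *\<^sub>R x"
    and norm_s: "norm (s c x) = norm c * norm x"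

definition infinite_dimensional :: "('k::field \<Rightarrow> 'a::ab_group_add \<Rightarrow> 'a) \<Rightarrow> bool" where
  "infinite_dimensional s \<longleftrightarrow>
     vector_space s \<and> (\<nexists>B. finite_dimensional_vector_space s B)"

definition proj_space :: "('k::field \<Rightarrow> 'a::ab_group_add \<Rightarrow> 'a) \<Rightarrow> 'a set set" where
  "proj_space s = {P. module.subspace s P \<and> vector_space.dim s P = 1}"

definition GL :: "('k::field \<Rightarrow> 'a::real_normed_vector \<Rightarrow> 'a) \<Rightarrow> ('a \<Rightarrow> 'a) set" where
  "GL s = {u. Vector_Spaces.linear s s u \<and> bij u \<and> homeomorphism UNIV UNIV u (inv u)}"

definition PGL :: "('k::field \<Rightarrow> 'a::real_normed_vector \<Rightarrow> 'a) \<Rightarrow> ('a set \<Rightarrow> 'a set) set" where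
  "PGL s = {(\<lambda>P\<in>proj_space s. u ` P) |u. u \<in> GL s}"

definition PGLc_mapping ::
  "('k::field \<Rightarrow> 'a::real_normed_vector \<Rightarrow> 'a) \<Rightarrow> ('k \<Rightarrow> 'b::real_normed_vector \<Rightarrow> 'b) \<Rightarrow>
    ('a set \<Rightarrow> 'b set) \<Rightarrow> bool" where
  "PGLc_mapping s s' f \<longleftrightarrow>
     f \<in> proj_space s \<rightarrow> proj_space s' \<and>
     (\<forall>h\<in>PGL s. \<exists>h'\<in>PGL s'. \<forall>P\<in>proj_space s. f (h P) = h' (f P))"

definition field_hom :: "('k::field \<Rightarrow> 'k) \<Rightarrow> bool" where
  "field_hom \<sigma> \<longleftrightarrow>
     \<sigma> 1 = 1 \<and> (\<forall>a b. \<sigma> (a + b) = \<sigma> a + \<sigma> b) \<and> (\<forall>a b. \<sigma> (a * b) = \<sigma> a * \<sigma> b)"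

definition semilinear_wrt ::
  "('k::field \<Rightarrow> 'k) \<Rightarrow> ('k \<Rightarrow> 'a::ab_group_add \<Rightarrow> 'a) \<Rightarrow> ('k \<Rightarrow> 'b::ab_group_add \<Rightarrow> 'b) \<Rightarrow>
    ('a \<Rightarrow> 'b) \<Rightarrow> bool" where
  "semilinear_wrt \<sigma> s s' l \<longleftrightarrow>
     field_hom \<sigma> \<and> (\<forall>x y. l (x + y) = l x + l y) \<and> (\<forall>a x. l (s a x) = s' (\<sigma> a) (l x))"

definition semilinear_isomorphism ::
  "('k::field \<Rightarrow> 'a::ab_group_add \<Rightarrow> 'a) \<Rightarrow> ('k \<Rightarrow> 'b::ab_group_add \<Rightarrow> 'b) \<Rightarrow>
    ('a \<Rightarrow> 'b) \<Rightarrow> bool" where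
  "semilinear_isomorphism s s' l \<longleftrightarrow>
     bij l \<and> (\<exists>\<sigma>. bij \<sigma> \<and> semilinear_wrt \<sigma> s s' l)"

definition semilinear_homeomorphism ::
  "('k::field \<Rightarrow> 'a::real_normed_vector \<Rightarrow> 'a) \<Rightarrow> ('k \<Rightarrow> 'b::real_normed_vector \<Rightarrow> 'b) \<Rightarrow>
    ('a \<Rightarrow> 'b) \<Rightarrow> bool" where
  "semilinear_homeomorphism s s' l \<longleftrightarrow>
     semilinear_isomorphism s s' l \<and> homeomorphism UNIV UNIV l (inv l)"

definition induced_by ::
  "('k::field \<Rightarrow> 'a::ab_group_add \<Rightarrow> 'a) \<Rightarrow> ('a set \<Rightarrow> 'b set) \<Rightarrow> ('a \<Rightarrow> 'b) \<Rightarrow> bool" where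
  "induced_by s f l \<longleftrightarrow> (\<forall>P\<in>proj_space s. f P = l ` P)"

end

theory Submission
  imports Defs
begin

text \<open>
A semilinear homeomorphism conjugates the general linear groups into each other, which gives one direction.
For the other direction, let \<open>f\<close> be a bijection of the points that conjugates the two projective groups.

The supply of group elements comes from the Hahn--Banach theorem (\<open>ex_linear_le_sublinear\<close>): continuous
functionals separate points from finite-dimensional subspaces, and the maps \<open>x \<mapsto> x + \<phi> x a\<close> with
\<open>\<phi>\<close> continuous and \<open>1 + \<phi> a \<noteq> 0\<close> belong to the general linear group.

Collinearity is determined by the permutation group: three distinct points are collinear if and only if their common
stabilizer fixes a fourth point. So \<open>f\<close> and its inverse preserve lines (\<open>F_collinear_iff\<close>) and \<open>f\<close>
maps a closed hyperplane onto a hyperplane. In the affine charts that belong to the two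
hyperplanes, conjugation by the map \<open>l\<close> that \<open>f\<close> gives carries translations and dilations to translations
and dilations, because these are induced by the linear maps that fix all points of the hyperplane. Hence
\<open>l\<close> is additive and homogeneous up to a field automorphism \<open>\<sigma>\<close>, and \<open>f\<close> is induced by a semilinear
bijection \<open>L\<close> (\<open>ex_semilinear\<close>).

Continuity is obtained from the dual spaces. The conjugate of a transvection by \<open>L\<close> is continuous, and its
functional is \<open>\<sigma> \<circ> \<phi> \<circ> inv L\<close>; so \<open>L\<close> and \<open>\<sigma>\<close> transport continuous functionals to continuous functionals
in both directions (\<open>dual_transport\<close>). In infinite dimension a gliding hump argument shows first that \<open>\<sigma>\<close>
preserves the norm (\<open>norm_\<sigma>\<close>), and a second one, which is the uniform boundedness principle on the dual
space, that \<open>L\<close> is bounded (\<open>L_bounded\<close>). By symmetry the inverse of \<open>L\<close> is bounded, too.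

All of this is carried out over an arbitrary complete normed field, for spaces with norming functionals. The real
and the complex case differ only in the proof that norming functionals exist.
\<close>

section \<open>Norming functionals\<close>

definition sublinear :: "('a::real_vector \<Rightarrow> real) \<Rightarrow> bool" where
  "sublinear p \<longleftrightarrow> (\<forall>x y. p (x + y) \<le> p x + p y) \<and> (\<forall>t\<ge>0. \<forall>x. p (t *\<^sub>R x) \<le> t * p x)"

lemma sublinear_add: "sublinear p \<Longrightarrow> p (x + y) \<le> p x + p y"
  by (simp add: sublinear_def)

lemma sublinear_scale:
  assumes "sublinear p" "0 \<le> t"
  shows "p (t *\<^sub>R x) = t * p x"
proof (cases "t = 0")
  case True
  then show ?thesis
    using assms sublinear_add[of p 0 0] unfolding sublinear_def by force
next
  case False
  then have "p x \<le> (1/t) * p (t *\<^sub>R x)"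
    using assms unfolding sublinear_def
    by (metis (no_types, lifting) divide_self_if divide_nonneg_nonneg scaleR_one scaleR_scaleR
        times_divide_eq_left mult_1 zero_le_one)
  then have "t * p x \<le> p (t *\<^sub>R x)"
    using False assms(2) by (simp add: field_simps)
  with assms show ?thesis by (simp add: sublinear_def antisym)
qed

lemma sublinear_minus:
  assumes "sublinear p" shows "- p (- x) \<le> p x"
  using sublinear_add[OF assms, of x "- x"] sublinear_scale[OF assms, of 0 0] by simp

text \<open>
Tilting a sublinear functional \<open>p\<close> along \<open>a\<close> is the device that makes linear functionals appear:
the result lies below \<open>p\<close>, and taking the term \<open>t = 1\<close> at the point \<open>- a\<close> forces its
value there down to \<open>- p a\<close>. A functional that no tilt lowers turns out to be linear, and a single tilt of
the norm makes every linear functional below it attain the norm at \<open>a\<close>.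
\<close>
definition tilt :: "('a::real_vector \<Rightarrow> real) \<Rightarrow> 'a \<Rightarrow> 'a \<Rightarrow> real" where
  "tilt p a x = (INF t\<in>{0..}. p (x + t *\<^sub>R a) - t * p a)"

lemma tilt_le:
  assumes "sublinear p" "0 \<le> t"
  shows "tilt p a x \<le> p (x + t *\<^sub>R a) - t * p a"
  unfolding tilt_def
proof (rule cINF_lower)
  have "- p (- x) \<le> p (x + t *\<^sub>R a) - t * p a" if "0 \<le> t" for t
    using sublinear_add[OF assms(1), of "x + t *\<^sub>R a" "- x"] sublinear_scale[OF assms(1) that, of a]
    by simp
  then show "bdd_below ((\<lambda>t. p (x + t *\<^sub>R a) - t * p a) ` {0..})"
    by (intro bdd_belowI2[of _ "- p (- x)"]) auto
qed (use assms in auto)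

lemma tilt_greatest:
  assumes "\<And>t. 0 \<le> t \<Longrightarrow> m \<le> p (x + t *\<^sub>R a) - t * p a"
  shows "m \<le> tilt p a x"
  unfolding tilt_def by (rule cINF_greatest) (use assms in auto)

lemma sublinear_tilt:
  assumes p: "sublinear p"
  shows "sublinear (tilt p a)"
  unfolding sublinear_def
proof (intro conjI allI impI)
  fix x y
  have *: "tilt p a (x + y) \<le> (p (x + t *\<^sub>R a) - t * p a) + (p (y + u *\<^sub>R a) - u * p a)"
    if "0 \<le> t" "0 \<le> u" for t u
    using tilt_le[OF p, of "t + u" a "x + y"] that
      sublinear_add[OF p, of "x + t *\<^sub>R a" "y + u *\<^sub>R a"]
    by (simp add: algebra_simps)
  have "tilt p a (x + y) - (p (x + t *\<^sub>R a) - t * p a) \<le> tilt p a y" if "0 \<le> t" for t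
    by (rule tilt_greatest) (use *[OF that] in \<open>simp add: diff_le_eq add.commute\<close>)
  then have "tilt p a (x + y) - tilt p a y \<le> tilt p a x"
    by (intro tilt_greatest) (simp add: diff_le_eq add.commute)
  then show "tilt p a (x + y) \<le> tilt p a x + tilt p a y" by simp
next
  fix t :: real and x
  assume t: "0 \<le> t"
  show "tilt p a (t *\<^sub>R x) \<le> t * tilt p a x"
  proof (cases "t = 0")
    case True
    then show ?thesis
      using tilt_le[OF p, of 0 a 0] sublinear_scale[OF p, of 0 0] by simp
  next
    case False
    have "tilt p a (t *\<^sub>R x) / t \<le> tilt p a x"
    proof (rule tilt_greatest)
      fix u :: real assume u: "0 \<le> u"
      have "tilt p a (t *\<^sub>R x) \<le> p (t *\<^sub>R x + (t * u) *\<^sub>R a) - (t * u) * p a"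
        using tilt_le[OF p, of "t * u"] t u by simp
      also have "\<dots> = t * (p (x + u *\<^sub>R a) - u * p a)"
        using sublinear_scale[OF p t, of "x + u *\<^sub>R a"] by (simp add: algebra_simps)
      finally show "tilt p a (t *\<^sub>R x) / t \<le> p (x + u *\<^sub>R a) - u * p a"
        using False t by (simp add: field_simps)
    qed
    then show ?thesis using False t by (simp add: field_simps)
  qed
qed

text \<open>
Minimality says that all tilts leave \<open>p\<close> unchanged. The term \<open>t = 1\<close> of the tilt along \<open>a\<close>
then reads \<open>p x + p a \<le> p (x + a)\<close>, the inequality opposite to subadditivity.
\<close>
lemma minimal_sublinear_imp_linear:
  assumes p: "sublinear p"
    and minimal: "\<And>q. sublinear q \<Longrightarrow> (\<And>x. q x \<le> p x) \<Longrightarrow> q = p"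
  shows "linear p"
proof -
  have tilt: "tilt p a = p" for a
    using tilt_le[OF p, of 0 a] by (intro minimal sublinear_tilt p) simp
  have add: "p (x + a) = p x + p a" for x a
    using tilt_le[OF p, of 1 a x] sublinear_add[OF p, of x a] unfolding tilt by simp
  have minus: "p (- x) = - p x" for x
    using add[of x "- x"] sublinear_scale[OF p, of 0 0] by simp
  have "p (t *\<^sub>R x) = t * p x" for t x
  proof (cases "0 \<le> t")
    case False
    then show ?thesis
      using sublinear_scale[OF p, of "- t" x] minus[of "t *\<^sub>R x"] by simp
  qed (rule sublinear_scale[OF p])
  with add show ?thesis by (intro linearI) auto
qed

text \<open>
The Hahn--Banach theorem in the form "minimal sublinear functionals exist". Zorn's lemma is applied
to the reversed pointwise order; a chain is bounded by its pointwise infimum, which is finite because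
\<open>- p (- x) \<le> q x\<close> for all sublinear \<open>q\<close> below \<open>p\<close>.
\<close>
lemma ex_linear_le_sublinear:
  assumes p: "sublinear p"
  obtains f where "linear f" "\<And>x. f x \<le> p x"
proof -
  define A where "A = {q. sublinear q \<and> (\<forall>x. q x \<le> p x)}"
  let ?P = "\<lambda>q r. \<forall>x. r x \<le> q x"
  have "\<exists>m\<in>A. \<forall>q\<in>A. ?P m q \<longrightarrow> q = m"
  proof (rule predicate_Zorn)
    show "partial_order_on A (relation_of ?P A)"
      by (rule partial_order_on_relation_ofI) (auto intro: order.trans antisym simp: fun_eq_iff)
  next
    fix C assume C: "C \<in> Chains (relation_of ?P A)"
    then have CA: "C \<subseteq> A" and chain: "\<And>q r. q \<in> C \<Longrightarrow> r \<in> C \<Longrightarrow> ?P q r \<or> ?P r q"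
      unfolding Chains_def relation_of_def by auto
    show "\<exists>u\<in>A. \<forall>q\<in>C. ?P q u"
    proof (cases "C = {}")
      case True
      with p show ?thesis by (auto simp: A_def)
    next
      case False
      define u where "u x = (INF q\<in>C. q x)" for x
      have bound: "- p (- x) \<le> q x" if "q \<in> C" for q x
      proof -
        have "sublinear q" "q (- x) \<le> p (- x)" using CA that by (auto simp: A_def)
        then show ?thesis using sublinear_minus[of q x] by linarith
      qed
      have u_le: "u x \<le> q x" if "q \<in> C" for q x
        unfolding u_def by (rule cINF_lower) (use bound that in \<open>auto intro!: bdd_belowI2\<close>)
      have u_ge: "m \<le> u x" if "\<And>q. q \<in> C \<Longrightarrow> m \<le> q x" for m x
        unfolding u_def by (rule cINF_greatest) (use False that in auto)
      have sub: "sublinear q" if "q \<in> C" for q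
        using CA that by (auto simp: A_def)
      have "sublinear u"
        unfolding sublinear_def
      proof (intro conjI allI impI)
        fix x y
        have *: "u (x + y) \<le> q x + r y" if q: "q \<in> C" and r: "r \<in> C" for q r
          using chain[OF q r]
        proof
          assume "?P q r"
          then have "r x \<le> q x" by blast
          then show ?thesis
            using u_le[OF r, of "x + y"] sublinear_add[OF sub[OF r], of x y] by linarith
        next
          assume "?P r q"
          then have "q y \<le> r y" by blast
          then show ?thesis
            using u_le[OF q, of "x + y"] sublinear_add[OF sub[OF q], of x y] by linarith
        qed
        have "u (x + y) - q x \<le> u y" if "q \<in> C" for q
          by (rule u_ge) (use *[OF that] in \<open>simp add: diff_le_eq add.commute\<close>)
        then have "u (x + y) - u y \<le> u x"
          by (intro u_ge) (simp add: diff_le_eq add.commute)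
        then show "u (x + y) \<le> u x + u y" by simp
      next
        fix t :: real and x
        assume t: "0 \<le> t"
        show "u (t *\<^sub>R x) \<le> t * u x"
        proof (cases "t = 0")
          case True
          obtain q where q: "q \<in> C" using False by auto
          then show ?thesis
            using True u_le[OF q, of 0] sublinear_scale[OF sub[OF q], of 0 0] by simp
        next
          case False
          have "u (t *\<^sub>R x) / t \<le> u x"
          proof (rule u_ge)
            fix q assume q: "q \<in> C"
            then show "u (t *\<^sub>R x) / t \<le> q x"
              using u_le[OF q, of "t *\<^sub>R x"] sublinear_scale[OF sub[OF q] t, of x] False t
              by (simp add: field_simps)
          qed
          then show ?thesis using False t by (simp add: field_simps)
        qed
      qed
      moreover have "u x \<le> p x" for x
      proof -
        obtain q where q: "q \<in> C" using \<open>C \<noteq> {}\<close> by auto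
        then have "q x \<le> p x" using CA by (auto simp: A_def)
        with u_le[OF q, of x] show ?thesis by linarith
      qed
      ultimately show ?thesis using u_le by (auto simp: A_def)
    qed
  qed
  then obtain m where m: "m \<in> A" "\<And>q. q \<in> A \<Longrightarrow> ?P m q \<Longrightarrow> q = m" by blast
  have "linear m"
  proof (rule minimal_sublinear_imp_linear)
    show "sublinear m" using m(1) by (simp add: A_def)
    show "q = m" if "sublinear q" "\<And>x. q x \<le> m x" for q
      using that m(1) by (intro m(2)) (auto simp: A_def intro: order.trans)
  qed
  with m(1) that show ?thesis by (auto simp: A_def)
qed

text \<open>
A linear functional below the norm tilted along \<open>a\<close> takes a value of at most \<open>- norm a\<close> at \<open>- a\<close>,
hence at least \<open>norm a\<close> at \<open>a\<close>.
\<close>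
theorem ex_real_norming_functional:
  fixes a :: "'a::real_normed_vector"
  obtains f where "linear f" "\<And>x. \<bar>f x\<bar> \<le> norm x" "f a = norm a"
proof -
  have "sublinear (norm :: 'a \<Rightarrow> real)"
    by (simp add: sublinear_def norm_triangle_ineq)
  note tilt = sublinear_tilt[OF this, of a] tilt_le[OF this, of _ a]
  obtain f where f: "linear f" "\<And>x. f x \<le> tilt norm a x"
    using ex_linear_le_sublinear[OF tilt(1)] by blast
  have le: "f x \<le> norm x" for x
    using f(2)[of x] tilt(2)[of 0 x] by simp
  have "\<bar>f x\<bar> \<le> norm x" for x
    using le[of x] le[of "- x"] linear_neg[OF f(1)] by (simp add: abs_le_iff)
  moreover have "norm a \<le> f a"
    using f(2)[of "- a"] tilt(2)[of 1 "- a"] linear_neg[OF f(1), of a] by simp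
  ultimately show ?thesis
    using le[of a] f(1) that by (meson antisym)
qed

section \<open>Continuous functionals and rank one perturbations of the identity\<close>

text \<open>
Continuity is expressed by a norm bound, so that no operator norm has to be defined for functionals
that are linear over an abstract scalar multiplication.
\<close>
definition dual :: "('k::real_normed_field \<Rightarrow> 'a::real_normed_vector \<Rightarrow> 'a) \<Rightarrow> ('a \<Rightarrow> 'k) set" where
  "dual s = {\<phi>. (\<forall>x y. \<phi> (x + y) = \<phi> x + \<phi> y) \<and> (\<forall>c x. \<phi> (s c x) = c * \<phi> x) \<and>
     (\<exists>C. \<forall>x. norm (\<phi> x) \<le> C * norm x)}"

lemma dualI:
  assumes "\<And>x y. \<phi> (x + y) = \<phi> x + \<phi> y" "\<And>c x. \<phi> (s c x) = c * \<phi> x"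
    "\<And>x. norm (\<phi> x) \<le> C * norm x"
  shows "\<phi> \<in> dual s"
  using assms by (auto simp: dual_def)

lemma dual_add: "\<phi> \<in> dual s \<Longrightarrow> \<phi> (x + y) = \<phi> x + \<phi> y"
  and dual_scale: "\<phi> \<in> dual s \<Longrightarrow> \<phi> (s c x) = c * \<phi> x"
  by (simp_all add: dual_def)

lemma dual_bounded:
  assumes "\<phi> \<in> dual s"
  obtains C where "C > 0" "\<And>x. norm (\<phi> x) \<le> C * norm x"
proof -
  obtain C where C: "\<And>x. norm (\<phi> x) \<le> C * norm x"
    using assms by (auto simp: dual_def)
  have "norm (\<phi> x) \<le> max C 1 * norm x" for x
    using C[of x] mult_right_mono[of C "max C 1" "norm x"] by simp
  then show ?thesis using that[of "max C 1"] by simp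
qed

lemma dual_zero: "\<phi> \<in> dual s \<Longrightarrow> \<phi> 0 = 0"
  using dual_add[of \<phi> s 0 0] by simp

lemma dual_minus: "\<phi> \<in> dual s \<Longrightarrow> \<phi> (- x) = - \<phi> x"
  using dual_add[of \<phi> s x "- x"] dual_zero[of \<phi> s] by (simp add: eq_neg_iff_add_eq_0 add.commute)

lemma dual_diff: "\<phi> \<in> dual s \<Longrightarrow> \<phi> (x - y) = \<phi> x - \<phi> y"
  using dual_add[of \<phi> s x "- y"] dual_minus[of \<phi> s y] by simp

lemma dual_cmult:
  assumes "\<phi> \<in> dual s" shows "(\<lambda>x. c * \<phi> x) \<in> dual s"
proof -
  obtain C where C: "\<And>x. norm (\<phi> x) \<le> C * norm x" using dual_bounded[OF assms] by blast
  have "norm (c * \<phi> x) \<le> norm c * C * norm x" for x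
    using mult_left_mono[OF C[of x], of "norm c"] by (simp add: norm_mult mult.assoc)
  then show ?thesis
    using dual_add[OF assms] dual_scale[OF assms]
    by (intro dualI[where C = "norm c * C"]) (auto simp: algebra_simps)
qed

lemma dual_diff_fun:
  assumes "\<phi> \<in> dual s" "\<psi> \<in> dual s" shows "(\<lambda>x. \<phi> x - \<psi> x) \<in> dual s"
proof -
  obtain C where C: "\<And>x. norm (\<phi> x) \<le> C * norm x" using dual_bounded[OF assms(1)] by blast
  obtain D where D: "\<And>x. norm (\<psi> x) \<le> D * norm x" using dual_bounded[OF assms(2)] by blast
  have "norm (\<phi> x - \<psi> x) \<le> (C + D) * norm x" for x
    using norm_triangle_ineq4[of "\<phi> x" "\<psi> x"] C[of x] D[of x] by (simp add: algebra_simps)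
  then show ?thesis
    using assms by (intro dualI[where C = "C + D"]) (auto simp: dual_add dual_scale algebra_simps)
qed

text \<open>
The one instance of completeness of the dual space that the gliding hump arguments below need:
the space itself may be incomplete, only the scalars have to be complete.
\<close>
lemma dual_suminf:
  fixes \<theta> :: "nat \<Rightarrow> 'a::real_normed_vector \<Rightarrow> 'k::{real_normed_field,banach}"
  assumes \<theta>: "\<And>n. \<theta> n \<in> dual s"
    and bound: "\<And>n x. norm (\<theta> n x) \<le> b n * norm x" and b: "summable b"
  shows "(\<lambda>x. \<Sum>n. \<theta> n x) \<in> dual s" and "summable (\<lambda>n. \<theta> n x)"
proof -
  have sn: "summable (\<lambda>n. norm (\<theta> n x))" for x
    by (rule summable_comparison_test'[OF summable_mult2[OF b, of "norm x"], of 0])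
       (use bound in auto)
  then show sum: "summable (\<lambda>n. \<theta> n x)" for x
    by (rule summable_norm_cancel)
  show "(\<lambda>x. \<Sum>n. \<theta> n x) \<in> dual s"
  proof (rule dualI[where C = "suminf b"])
    show "(\<Sum>n. \<theta> n (x + y)) = (\<Sum>n. \<theta> n x) + (\<Sum>n. \<theta> n y)" for x y
      using suminf_add[OF sum sum, of x y] dual_add[OF \<theta>] by simp
    show "(\<Sum>n. \<theta> n (s c x)) = c * (\<Sum>n. \<theta> n x)" for c x
      using suminf_mult[OF sum, of c x] dual_scale[OF \<theta>] by simp
    show "norm (\<Sum>n. \<theta> n x) \<le> suminf b * norm x" for x
    proof -
      have "norm (\<Sum>n. \<theta> n x) \<le> (\<Sum>n. norm (\<theta> n x))" by (rule summable_norm[OF sn])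
      also have "\<dots> \<le> (\<Sum>n. b n * norm x)"
        by (rule suminf_le[OF bound sn summable_mult2[OF b]])
      finally show ?thesis using suminf_mult2[OF b, of "norm x"] by simp
    qed
  qed
qed

text \<open>
The common ground of the real and the complex case. Everything below is deduced for a complete normed
field from the existence of norming functionals alone.
\<close>
locale norming_space = normed_space s
  for s :: "'k::{real_normed_field,banach} \<Rightarrow> 'a::real_normed_vector \<Rightarrow> 'a" +
  assumes ex_norming: "\<exists>\<phi>\<in>dual s. (\<forall>y. norm (\<phi> y) \<le> norm y) \<and> \<phi> x = of_real (norm x)"

lemma norming_space_real:
  fixes s :: "real \<Rightarrow> 'a::real_normed_vector \<Rightarrow> 'a"
  assumes "normed_space s"
  shows "norming_space s"
proof -
  interpret normed_space s by fact
  show ?thesis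
  proof
    fix x :: 'a
    obtain f where f: "linear f" "\<And>y. \<bar>f y\<bar> \<le> norm y" "f x = norm x"
      using ex_real_norming_functional by blast
    have "f \<in> dual s"
      using f(1,2) s_of_real linear_add[OF f(1)] linear_scale[OF f(1)]
      by (intro dualI[where C = 1]) auto
    with f show "\<exists>\<phi>\<in>dual s. (\<forall>y. norm (\<phi> y) \<le> norm y) \<and> \<phi> x = of_real (norm x)" by auto
  qed
qed

text \<open>
A real functional \<open>f\<close> is the real part of the complex functional \<open>f y - \<i> f (\<i> y)\<close>. The bound carries
over because \<open>y\<close> can be multiplied by a scalar of modulus 1 that makes the value real.
\<close>
lemma norming_space_complex:
  fixes s :: "complex \<Rightarrow> 'a::real_normed_vector \<Rightarrow> 'a"
  assumes "normed_space s"
  shows "norming_space s"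
proof -
  interpret normed_space s by fact
  show ?thesis
  proof
    fix x :: 'a
    obtain f where f: "linear f" "\<And>y. \<bar>f y\<bar> \<le> norm y" "f x = norm x"
      using ex_real_norming_functional by blast
    note fs = linear_add[OF f(1)] linear_scale[OF f(1)] linear_neg[OF f(1)]
    define \<phi> where "\<phi> y = Complex (f y) (- f (s \<i> y))" for y
    have add: "\<phi> (y + z) = \<phi> y + \<phi> z" for y z
      by (simp add: \<phi>_def fs scale_right_distrib complex_eq_iff)
    have sc: "s c y = Re c *\<^sub>R y + Im c *\<^sub>R s \<i> y" for c y
    proof -
      have "s c y = s (of_real (Re c) + of_real (Im c) * \<i>) y"
        by (simp add: complex_eq mult.commute)
      also have "\<dots> = Re c *\<^sub>R y + Im c *\<^sub>R s \<i> y"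
        by (simp only: scale_left_distrib scale_scale[symmetric] s_of_real)
      finally show ?thesis .
    qed
    have scale: "\<phi> (s c y) = c * \<phi> y" for c y
    proof -
      have "s \<i> (s c y) = Re c *\<^sub>R s \<i> y - Im c *\<^sub>R y"
        using sc[of "\<i> * c" y] by simp
      then show ?thesis
        using linear_diff[OF f(1)] by (simp add: sc[of c y] \<phi>_def fs complex_eq_iff)
    qed
    \<comment> \<open>rotate \<open>y\<close> by a unimodular \<open>c\<close> until the value is real\<close>
    have bound: "norm (\<phi> y) \<le> norm y" for y
    proof (cases "\<phi> y = 0")
      case False
      define c where "c = of_real (norm (\<phi> y)) / \<phi> y"
      have c: "norm c = 1" using False by (simp add: c_def norm_divide)
      have "of_real (norm (\<phi> y)) = \<phi> (s c y)" using False by (simp add: scale c_def)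
      then have "norm (\<phi> y) = f (s c y)" by (simp add: \<phi>_def complex_eq_iff)
      also have "\<dots> \<le> norm y" using f(2)[of "s c y"] norm_s[of c y] c by simp
      finally show ?thesis .
    qed simp
    have Re: "Re (\<phi> x) = norm x" by (simp add: \<phi>_def f(3))
    \<comment> \<open>a complex number whose real part is at least its modulus is that real part\<close>
    have "\<phi> x = of_real (norm x)"
    proof -
      have "(norm (\<phi> x))\<^sup>2 \<le> (norm x)\<^sup>2" using bound[of x] by (simp add: power_mono)
      then show ?thesis using Re by (simp add: cmod_power2 complex_eq_iff)
    qed
    moreover have "\<phi> \<in> dual s" using add scale bound by (intro dualI[where C = 1]) auto
    ultimately show "\<exists>\<phi>\<in>dual s. (\<forall>y. norm (\<phi> y) \<le> norm y) \<and> \<phi> x = of_real (norm x)"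
      using bound by blast
  qed
qed

lemma additive_bounded_imp_continuous:
  fixes u :: "'a::real_normed_vector \<Rightarrow> 'b::real_normed_vector"
  assumes add: "\<And>x y. u (x + y) = u x + u y" and bounded: "\<And>x. norm (u x) \<le> C * norm x"
  shows "continuous_on UNIV u"
proof (rule lipschitz_on_continuous_on)
  have diff: "u (x - y) = u x - u y" for x y
    using add[of "x - y" y] by simp
  have "norm (u x) \<le> max C 0 * norm x" for x
    using bounded[of x] mult_right_mono[of C "max C 0" "norm x"] by simp
  then show "(max C 0)-lipschitz_on UNIV u"
    by (intro lipschitz_onI) (auto simp: dist_norm diff[symmetric])
qed

context normed_space
begin

lemma in_span_pair: "z \<in> span {x, y} \<longleftrightarrow> (\<exists>a b. z = s a x + s b y)"
proof -
  have "z \<in> span {x, y} \<longleftrightarrow> (\<exists>a b. z - s a x = s b y)"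
    by (auto simp: span_breakdown_eq[of z x "{y}"] span_singleton)
  then show ?thesis by (metis add_diff_cancel_left' diff_add_cancel add.commute)
qed

lemma in_span_single: "z \<in> span {x} \<longleftrightarrow> (\<exists>a. z = s a x)"
  by (auto simp: span_singleton)

lemma span_single_eq:
  assumes "y \<in> span {x}" "y \<noteq> 0" shows "span {y} = span {x}"
proof -
  obtain a where a: "y = s a x" using assms by (auto simp: in_span_single)
  with assms(2) have "s (1/a) y = x" by auto
  then have "x \<in> span {y}" by (metis in_span_single)
  with assms(1) show ?thesis by (simp add: span_eq)
qed

lemma proj_space_iff: "P \<in> proj_space s \<longleftrightarrow> (\<exists>x. x \<noteq> 0 \<and> P = span {x})"
proof
  assume P: "P \<in> proj_space s"
  then have *: "subspace P" "dim P = 1" by (auto simp: proj_space_def)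
  obtain B where B: "B \<subseteq> P" "independent B" "P \<subseteq> span B" "card B = dim P"
    using basis_exists by blast
  with * obtain x where x: "B = {x}" by (auto simp: card_1_singleton_iff)
  then have "P = span {x}" using B * span_minimal by blast
  with x B show "\<exists>x. x \<noteq> 0 \<and> P = span {x}" by (metis dependent_single)
next
  assume "\<exists>x. x \<noteq> 0 \<and> P = span {x}"
  then show "P \<in> proj_space s"
    using dim_span_eq_card_independent[of "{_}"] by (auto simp: proj_space_def)
qed

lemma GLI:
  assumes add: "\<And>x y. u (x + y) = u x + u y" and scale: "\<And>c x. u (s c x) = s c (u x)"
    and inverse: "\<And>x. v (u x) = x" "\<And>x. u (v x) = x"
    and bounded: "\<And>x. norm (u x) \<le> C * norm x" "\<And>x. norm (v x) \<le> D * norm x"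
  shows "u \<in> GL s"
proof -
  have bij: "bij u" using inverse by (metis bijI')
  have inv: "inv u = v" using inverse by (metis inv_equality)
  have "v (x + y) = v x + v y" for x y
    using add[of "v x" "v y"] inverse by metis
  then have "continuous_on UNIV v" using bounded(2) by (rule additive_bounded_imp_continuous)
  moreover have "continuous_on UNIV u" using add bounded(1) by (rule additive_bounded_imp_continuous)
  ultimately have "homeomorphism UNIV UNIV u (inv u)"
    unfolding inv homeomorphism_def using inverse by (auto intro!: image_eqI[of _ u "v _"] image_eqI[of _ v "u _"] simp: surj_def) metis+
  then show ?thesis
    using bij add scale by (simp add: GL_def Vector_Spaces.linear_iff vector_space_axioms)
qed

lemma GL_add: "u \<in> GL s \<Longrightarrow> u (x + y) = u x + u y"
  and GL_scale: "u \<in> GL s \<Longrightarrow> u (s c x) = s c (u x)"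
  and GL_bij: "u \<in> GL s \<Longrightarrow> bij u"
  by (auto simp: GL_def Vector_Spaces.linear_iff)

lemma GL_zero: "u \<in> GL s \<Longrightarrow> u 0 = 0"
  using GL_add[of u 0 0] by simp

lemma GL_eq_0_iff: "u \<in> GL s \<Longrightarrow> u x = 0 \<longleftrightarrow> x = 0"
  using GL_zero GL_bij by (metis bij_pointE)

lemma GL_bounded:
  assumes u: "u \<in> GL s"
  obtains C where "\<And>x. norm (u x) \<le> C * norm x"
proof -
  have "continuous_on UNIV u" using u by (auto simp: GL_def homeomorphism_def)
  then have "\<exists>d>0. \<forall>x. norm x < d \<longrightarrow> norm (u x) < 1"
    using GL_zero[OF u] by (metis UNIV_I continuous_on_iff dist_0_norm dist_commute zero_less_one)
  then obtain d where d: "d > 0" "\<And>x. norm x < d \<Longrightarrow> norm (u x) < 1" by blast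
  have "norm (u x) \<le> (2 / d) * norm x" for x
  proof (cases "x = 0")
    case False
    define r where "r = d / (2 * norm x)"
    have r: "r > 0" using False d by (simp add: r_def)
    have "norm (r *\<^sub>R x) < d" using False d by (simp add: r_def)
    moreover have "u (r *\<^sub>R x) = r *\<^sub>R u x" using GL_scale[OF u, of "of_real r"] s_of_real by simp
    ultimately have "r * norm (u x) < 1" using d(2)[of "r *\<^sub>R x"] r by simp
    then show ?thesis using False d(1) by (simp add: r_def field_simps)
  qed (simp add: GL_zero[OF u])
  then show ?thesis using that by blast
qed

lemma GL_image_span: 
  assumes "u \<in> GL s" shows "u ` span {x} = span {u x}"
  by (auto simp: span_singleton GL_scale[OF assms] image_image)

text \<open>
The inverse has the same form, with \<open>\<phi>\<close> multiplied by \<open>- 1 / (1 + \<phi> a)\<close>. These maps are the only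
elements of the general linear group that have to be exhibited: transvections when \<open>\<phi> a = 0\<close>,
and dilations otherwise.
\<close>
lemma rank_one_perturbation_GL:
  assumes \<phi>: "\<phi> \<in> dual s" and a: "1 + \<phi> a \<noteq> 0"
  shows "(\<lambda>x. x + s (\<phi> x) a) \<in> GL s"
proof -
  obtain C where C: "\<And>x. norm (\<phi> x) \<le> C * norm x" using dual_bounded[OF \<phi>] by blast
  have bounded: "norm (x + s (c * \<phi> x) a) \<le> (1 + norm c * C * norm a) * norm x" for c x
  proof -
    have "norm (x + s (c * \<phi> x) a) \<le> norm x + norm c * norm (\<phi> x) * norm a"
      using norm_triangle_ineq[of x "s (c * \<phi> x) a"] by (simp add: norm_s norm_mult)
    also have "\<dots> \<le> norm x + norm c * (C * norm x) * norm a"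
      by (intro add_left_mono mult_right_mono mult_left_mono C) auto
    finally show ?thesis by (simp add: algebra_simps)
  qed
  define d where "d = - 1 / (1 + \<phi> a)"
  have d: "d + d * \<phi> a = - 1" unfolding d_def using a by (simp add: field_simps)
  show ?thesis
  proof (rule GLI[where v = "\<lambda>x. x + s (d * \<phi> x) a"])
    show "norm (x + s (\<phi> x) a) \<le> (1 + norm (1::'k) * C * norm a) * norm x" for x
      using bounded[of x 1] by simp
    show "norm (x + s (d * \<phi> x) a) \<le> (1 + norm d * C * norm a) * norm x" for x
      by (rule bounded)
    have *: "\<phi> x + d * (\<phi> x + \<phi> x * \<phi> a) = 0" for x
    proof -
      have "\<phi> x + d * (\<phi> x + \<phi> x * \<phi> a) = \<phi> x * (1 + (d + d * \<phi> a))" by (simp add: algebra_simps)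
      then show ?thesis using d by simp
    qed
    show "x + s (\<phi> x) a + s (d * \<phi> (x + s (\<phi> x) a)) a = x" for x
      using *[of x] by (simp add: dual_add[OF \<phi>] dual_scale[OF \<phi>] add.assoc scale_left_distrib[symmetric])
    have **: "d * \<phi> x + (\<phi> x + d * \<phi> x * \<phi> a) = 0" for x
    proof -
      have "d * \<phi> x + (\<phi> x + d * \<phi> x * \<phi> a) = \<phi> x * (1 + (d + d * \<phi> a))" by (simp add: algebra_simps)
      then show ?thesis using d by simp
    qed
    show "x + s (d * \<phi> x) a + s (\<phi> (x + s (d * \<phi> x) a)) a = x" for x
      using **[of x] by (simp add: dual_add[OF \<phi>] dual_scale[OF \<phi>] add.assoc scale_left_distrib[symmetric])
  qed (simp_all add: dual_add[OF \<phi>] dual_scale[OF \<phi>] algebra_simps scale_left_distrib scale_right_distrib)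
qed

lemma dual_vanishes_on_span:
  assumes "\<phi> \<in> dual s" "\<And>b. b \<in> B \<Longrightarrow> \<phi> b = 0" "x \<in> span B"
  shows "\<phi> x = 0"
proof -
  have "subspace {x. \<phi> x = 0}"
    using assms(1) by (auto simp: subspace_def dual_zero dual_add dual_scale)
  then show ?thesis using span_minimal[of B "{x. \<phi> x = 0}"] assms(2,3) by auto
qed

end

context norming_space
begin

text \<open>
Norming functionals separate a point from 0. When a vector \<open>b\<close> is added to the annihilated set, a
functional \<open>\<phi>\<close> that is 1 at \<open>b\<close> corrects both the point and the functional that separates it.
\<close>
lemma ex_dual_separating:
  assumes "finite B" "x \<notin> span B"
  shows "\<exists>\<phi>\<in>dual s. (\<forall>b\<in>B. \<phi> b = 0) \<and> \<phi> x = 1"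
  using assms
proof (induction B arbitrary: x rule: finite_induct)
  case empty
  then have "x \<noteq> 0" by simp
  obtain \<phi> where "\<phi> \<in> dual s" "\<phi> x = of_real (norm x)" using ex_norming by blast
  then show ?case
    using \<open>x \<noteq> 0\<close> by (intro bexI[of _ "\<lambda>y. inverse (of_real (norm x)) * \<phi> y"] dual_cmult) auto
next
  case (insert b B)
  show ?case
  proof (cases "b \<in> span B")
    case True
    then have "x \<notin> span B" using insert.prems span_mono[of B "insert b B"] by blast
    then obtain \<phi> where \<phi>: "\<phi> \<in> dual s" "\<forall>b\<in>B. \<phi> b = 0" "\<phi> x = 1" using insert.IH by blast
    then have "\<phi> b = 0" using dual_vanishes_on_span[of \<phi> B b] True by blast
    with \<phi> show ?thesis by auto
  next
    case False
    then obtain \<phi> where \<phi>: "\<phi> \<in> dual s" "\<forall>b\<in>B. \<phi> b = 0" "\<phi> b = 1" using insert.IH by blast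
    have "x - s (\<phi> x) b \<notin> span B" using insert.prems by (auto simp: span_breakdown_eq)
    then obtain \<psi> where \<psi>: "\<psi> \<in> dual s" "\<forall>b\<in>B. \<psi> b = 0" "\<psi> (x - s (\<phi> x) b) = 1"
      using insert.IH by blast
    show ?thesis
    proof (intro bexI[of _ "\<lambda>y. \<psi> y - \<psi> b * \<phi> y"] dual_diff_fun dual_cmult \<phi> \<psi>)
      have "\<psi> x - \<phi> x * \<psi> b = 1"
        using \<psi>(3) dual_diff[OF \<psi>(1)] dual_scale[OF \<psi>(1)] by simp
      then show "(\<forall>c\<in>insert b B. \<psi> c - \<psi> b * \<phi> c = 0) \<and> \<psi> x - \<psi> b * \<phi> x = 1"
        using \<phi> \<psi> by (simp add: mult.commute)
    qed
  qed
qed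

text \<open>
A rank one perturbation of the identity in direction \<open>p\<close>, by a functional that vanishes at \<open>q\<close> and
\<open>r\<close>, fixes the three lines and pushes \<open>w\<close> off its line, towards \<open>p\<close>.
\<close>
lemma ex_GL_moving_point:
  assumes w: "w \<notin> span {q, r}" "w \<notin> span {p}" and p: "p \<noteq> 0"
  shows "\<exists>u\<in>GL s. u p \<in> span {p} \<and> u q = q \<and> u r = r \<and> u w \<notin> span {w}"
proof -
  obtain \<psi> where \<psi>: "\<psi> \<in> dual s" "\<psi> q = 0" "\<psi> r = 0" "\<psi> w = 1"
    using ex_dual_separating[OF _ w(1)] by auto
  \<comment> \<open>the sign avoids the value \<open>- 1\<close> at \<open>p\<close>, where the perturbation is singular\<close>
  define c :: 'k where "c = (if \<psi> p = - 1 then - 1 else 1)"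
  define \<phi> where "\<phi> x = c * \<psi> x" for x
  have \<phi>: "\<phi> \<in> dual s" unfolding \<phi>_def by (rule dual_cmult[OF \<psi>(1)])
  have nz: "1 + \<phi> p \<noteq> 0"
    by (auto simp: \<phi>_def c_def add_eq_0_iff)
  have "p \<in> span {w}" if "w + s c p \<in> span {w}"
  proof -
    have "s c p \<in> span {w}" using that span_diff[of "w + s c p" "{w}" w] span_base[of w "{w}"] by simp
    then have "s (1/c) (s c p) \<in> span {w}" by (rule span_scale)
    then show ?thesis by (simp add: c_def split: if_splits)
  qed
  then have "w + s c p \<notin> span {w}"
    using span_single_eq[OF _ p, of w] w(2) span_base[of w "{w}"] by auto
  moreover have "p + s (\<phi> p) p \<in> span {p}"
    by (intro span_add span_scale span_base) auto
  ultimately show ?thesis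
    using rank_one_perturbation_GL[OF \<phi> nz] \<psi> by (intro bexI[of _ "\<lambda>x. x + s (\<phi> x) p"]) (auto simp: \<phi>_def)
qed

end

section \<open>Collinearity in terms of the projective group\<close>

context normed_space
begin

lemma scale_in_span_iff: "c \<noteq> 0 \<Longrightarrow> s c y \<in> span S \<longleftrightarrow> y \<in> span S"
  using span_scale[of "s c y" S "1/c"] span_scale[of y S c] by auto

lemma independent_pair:
  assumes "s c x + s d y = 0" "y \<notin> span {x}" "x \<noteq> 0"
  shows "c = 0 \<and> d = 0"
proof -
  have "s d y = s (- c) x" using assms(1) by (simp add: eq_neg_iff_add_eq_0 add.commute)
  then have "s d y \<in> span {x}" unfolding in_span_single by blast
  then have "d = 0" using assms(2) scale_in_span_iff by blast
  then show ?thesis using assms by simp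
qed

lemma span_pair_cong:
  assumes "span {x} = span {x'}" "span {y} = span {y'}"
  shows "span {x, y} = span {x', y'}"
proof -
  have "span {x, y} = {a + b |a b. a \<in> span {x} \<and> b \<in> span {y}}" for x y
    using span_Un[of "{x}" "{y}"] by (simp add: insert_commute)
  with assms show ?thesis by simp
qed

text \<open>
Eigenvalues agree on any two independent vectors, because the sum of the two is an eigenvector as well.
\<close>
lemma eigenvectors_imp_scalar:
  assumes add: "\<And>x y. u (x + y) = u x + u y" and scale: "\<And>c x. u (s c x) = s c (u x)"
    and W: "subspace W" and eigen: "\<And>y. y \<in> W \<Longrightarrow> u y \<in> span {y}"
  shows "\<exists>c. \<forall>y\<in>W. u y = s c y"
proof (cases "W \<subseteq> {0}")
  case True
  then show ?thesis using add[of 0 0] by (intro exI[of _ 1]) auto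
next
  case False
  then obtain z where z: "z \<in> W" "z \<noteq> 0" by auto
  obtain c where c: "u z = s c z" using eigen[OF z(1)] by (auto simp: in_span_single)
  have "u y = s c y" if y: "y \<in> W" for y
  proof (cases "y \<in> span {z}")
    case True
    then show ?thesis using c by (auto simp: in_span_single scale mult.commute)
  next
    case False
    obtain d where d: "u y = s d y" using eigen[OF y] by (auto simp: in_span_single)
    have "z + y \<in> W" using W y z by (simp add: subspace_add)
    then obtain g where g: "u (z + y) = s g (z + y)" using eigen by (auto simp: in_span_single)
    have "s (g - c) z + s (g - d) y = 0"
      using g c d by (simp add: add algebra_simps scale_left_diff_distrib scale_right_distrib)
    then show ?thesis using independent_pair[OF _ False z(2), of "g - c" "g - d"] d by auto
  qed
  then show ?thesis by blast
qed

end

context norming_space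
begin

text \<open>
Three points that are not collinear have no further common fixed point under their stabilizer. The
planes \<open>span {q, r}\<close> and \<open>span {p, r}\<close> meet only in the line of \<open>r\<close>, so \<open>w\<close> avoids one of them and
can be moved in the direction of the remaining vertex.
\<close>
lemma ex_GL_fixing_triple_moving_point:
  assumes indep: "q \<notin> span {p}" "r \<notin> span {p, q}"
    and w: "w \<notin> span {p}" "w \<notin> span {q}" "w \<notin> span {r}"
    and nz: "p \<noteq> 0" "q \<noteq> 0"
  shows "\<exists>u\<in>GL s. u p \<in> span {p} \<and> u q \<in> span {q} \<and> u r \<in> span {r} \<and> u w \<notin> span {w}"
proof -
  have base: "x \<in> span {x}" for x by (simp add: span_base)
  have "w \<notin> span {q, r} \<or> w \<notin> span {p, r}"
  proof (rule ccontr)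
    assume "\<not> ?thesis"
    then obtain i j k m where ij: "w = s i q + s j r" and km: "w = s k p + s m r"
      unfolding in_span_pair by blast
    then have "s i q + s j r = s k p + s m r" by simp
    then have eq: "s (j - m) r = s k p + s (- i) q"
      unfolding scale_left_diff_distrib scale_minus_left by (simp add: algebra_simps)
    show False
    proof (cases "j = m")
      case True
      then have "k = 0" using independent_pair[of k p "- i" q] eq nz indep(1) by simp
      with km have "w \<in> span {r}" by (auto simp: in_span_single)
      with w show False by simp
    next
      case False
      have "s (j - m) r \<in> span {p, q}" unfolding eq in_span_pair by blast
      with False indep(2) show False by (simp add: scale_in_span_iff)
    qed
  qed
  then show ?thesis
  proof
    assume "w \<notin> span {q, r}"
    from ex_GL_moving_point[OF this w(1) nz(1)] base show ?thesis by metis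
  next
    assume "w \<notin> span {p, r}"
    from ex_GL_moving_point[OF this w(2) nz(2)] base show ?thesis by metis
  qed
qed

end

text \<open>
A bijection of projective spaces that conjugates the projective groups into each other, described by a
choice \<open>F x\<close> of a nonzero vector on the image of the line of \<open>x\<close>. Two equations \<open>cod.span {y} = cod.span {z}\<close>
of lines replace equations of points, so that no quotient has to be formed. The assumptions
are symmetric: a choice of representatives for the inverse satisfies them as well.
\<close>
locale PGL_conjugation =
  dom: norming_space s + cod: norming_space s'
  for s :: "'k::{real_normed_field,banach} \<Rightarrow> 'a::real_normed_vector \<Rightarrow> 'a"
    and s' :: "'k \<Rightarrow> 'b::real_normed_vector \<Rightarrow> 'b" +
  fixes F :: "'a \<Rightarrow> 'b"
  assumes F_nonzero: "x \<noteq> 0 \<Longrightarrow> F x \<noteq> 0"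
    and F_eq_iff: "x \<noteq> 0 \<Longrightarrow> y \<noteq> 0 \<Longrightarrow> cod.span {F x} = cod.span {F y} \<longleftrightarrow> dom.span {x} = dom.span {y}"
    and F_surj: "z \<noteq> 0 \<Longrightarrow> \<exists>x. x \<noteq> 0 \<and> cod.span {F x} = cod.span {z}"
    and conj: "u \<in> GL s \<Longrightarrow> \<exists>u'\<in>GL s'. \<forall>x. x \<noteq> 0 \<longrightarrow> cod.span {F (u x)} = cod.span {u' (F x)}"
    and conj_inv: "u' \<in> GL s' \<Longrightarrow> \<exists>u\<in>GL s. \<forall>x. x \<noteq> 0 \<longrightarrow> cod.span {F (u x)} = cod.span {u' (F x)}"
begin

lemma F_in_span_iff:
  assumes "x \<noteq> 0" "y \<noteq> 0"
  shows "F x \<in> cod.span {F y} \<longleftrightarrow> x \<in> dom.span {y}"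
  using cod.span_single_eq[of "F x" "F y"] dom.span_single_eq[of x y] F_eq_iff[OF assms] F_nonzero[OF assms(1)]
    cod.span_base[of "F x" "{F x}"] dom.span_base[of x "{x}"] assms by auto

text \<open>
Collinearity can be read off from the permutation group: a linear map that fixes three distinct
points of a line fixes every point of that line, while the common stabilizer of three points in general
position fixes no fourth point. So, if the images of the collinear points \<open>x\<close>, \<open>y\<close>, \<open>z\<close> were not
collinear, some automorphism would fix these images and move the image of a fourth point \<open>w\<close> of the
line; conjugating it back gives a contradiction.
\<close>
lemma F_collinear:
  assumes nz: "x \<noteq> 0" "y \<noteq> 0" "z \<noteq> 0" and z: "z \<in> dom.span {x, y}"
  shows "F z \<in> cod.span {F x, F y}"
proof (cases "y \<in> dom.span {x} \<or> z \<in> dom.span {x} \<or> z \<in> dom.span {y}")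
  case True
  moreover have "z \<in> dom.span {x}" if "y \<in> dom.span {x}"
    using z that dom.span_redundant[of y "{x}"] by (simp add: insert_commute)
  ultimately have "F z \<in> cod.span {F x} \<or> F z \<in> cod.span {F y}"
    using F_in_span_iff nz by blast
  then show ?thesis
    using cod.span_mono[of "{F x}" "{F x, F y}"] cod.span_mono[of "{F y}" "{F x, F y}"] by blast
next
  case False
  then have indep: "y \<notin> dom.span {x}" "z \<notin> dom.span {x}" "z \<notin> dom.span {y}" by auto
  have indep': "x \<notin> dom.span {z}" "y \<notin> dom.span {z}"
    using indep dom.span_single_eq[of x z] dom.span_single_eq[of y z] nz dom.span_base[of z "{z}"] by auto
  obtain a b where ab: "z = s a x + s b y" using z by (auto simp: dom.in_span_pair)
  have "b \<noteq> 0" "a \<noteq> 0"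
    using indep ab by (auto simp: dom.in_span_single)
  \<comment> \<open>a fourth point of the line, as \<open>w = a x + 2 b y\<close> and 2 is neither 0 nor 1\<close>
  define w where "w = z + s b y"
  have w: "w \<notin> dom.span {x}" "w \<notin> dom.span {y}" "w \<notin> dom.span {z}"
  proof -
    have "w = s a x + s (2 * b) y"
      by (simp add: w_def ab dom.scale_left_distrib[symmetric] add.assoc)
    moreover have "s a x \<in> dom.span {x}" "s a x \<notin> dom.span {y}"
      "s (2 * b) y \<in> dom.span {y}" "s (2 * b) y \<notin> dom.span {x}"
      using \<open>a \<noteq> 0\<close> \<open>b \<noteq> 0\<close> indep(1) dom.span_single_eq[of x y] nz
        dom.span_base[of x "{x}"] dom.span_base[of y "{y}"]
      by (auto simp: dom.scale_in_span_iff)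
    ultimately show "w \<notin> dom.span {x}" "w \<notin> dom.span {y}"
      using dom.span_add_eq[of "s a x" "{x}" "s (2 * b) y"] dom.span_add_eq2[of "s (2 * b) y" "{y}" "s a x"] by auto
    show "w \<notin> dom.span {z}"
      using indep'(2) \<open>b \<noteq> 0\<close> dom.span_base[of z "{z}"]
      by (simp add: w_def dom.span_add_eq dom.scale_in_span_iff)
  qed
  then have "w \<noteq> 0" using dom.span_zero by metis
  note nz = nz this
  have Fw: "F w \<notin> cod.span {F x}" "F w \<notin> cod.span {F y}" "F w \<notin> cod.span {F z}"
    using w nz by (simp_all add: F_in_span_iff)
  show ?thesis
  proof (rule ccontr)
    assume Fz: "F z \<notin> cod.span {F x, F y}"
    have "F y \<notin> cod.span {F x}" using indep(1) nz by (simp add: F_in_span_iff)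
    note cod.ex_GL_fixing_triple_moving_point[OF this Fz Fw F_nonzero F_nonzero, OF nz(1,2)]
    then obtain u' where u': "u' \<in> GL s'" "u' (F x) \<in> cod.span {F x}" "u' (F y) \<in> cod.span {F y}"
        "u' (F z) \<in> cod.span {F z}" "u' (F w) \<notin> cod.span {F w}" by blast
    obtain u where u: "u \<in> GL s" "\<And>x. x \<noteq> 0 \<Longrightarrow> cod.span {F (u x)} = cod.span {u' (F x)}"
      using conj_inv[OF u'(1)] by blast
    have fix_iff: "u v \<in> dom.span {v} \<longleftrightarrow> u' (F v) \<in> cod.span {F v}" if "v \<noteq> 0" for v
    proof -
      have "u v \<in> dom.span {v} \<longleftrightarrow> F (u v) \<in> cod.span {F v}"
        using F_in_span_iff that dom.GL_eq_0_iff[OF u(1)] by simp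
      also have "\<dots> \<longleftrightarrow> u' (F v) \<in> cod.span {F v}"
        using u(2)[OF that] cod.span_minimal[OF _ cod.subspace_span, of "{F (u v)}" "{F v}"]
          cod.span_minimal[OF _ cod.subspace_span, of "{u' (F v)}" "{F v}"]
          cod.span_base[of "F (u v)" "{F (u v)}"] cod.span_base[of "u' (F v)" "{u' (F v)}"]
        by auto
      finally show ?thesis .
    qed
    \<comment> \<open>three fixed points on a line have the same eigenvalue, by independence of \<open>x\<close> and \<open>y\<close>\<close>
    obtain i j k where ijk: "u x = s i x" "u y = s j y" "u z = s k z"
      using fix_iff u' nz unfolding dom.in_span_single by blast
    have "u z = s (a * i) x + s (b * j) y"
      unfolding ab by (simp add: dom.GL_add[OF u(1)] dom.GL_scale[OF u(1)] ijk)
    moreover have "s k z = s (k * a) x + s (k * b) y"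
      unfolding ab by (simp add: dom.scale_right_distrib)
    ultimately have "s ((k - i) * a) x + s ((k - j) * b) y = s k z - u z"
      by (simp add: left_diff_distrib dom.scale_left_diff_distrib mult.commute[of a] mult.commute[of b])
    then have "s ((k - i) * a) x + s ((k - j) * b) y = 0" using ijk by simp
    then have "(k - i) * a = 0 \<and> (k - j) * b = 0"
      by (rule dom.independent_pair[OF _ indep(1) nz(1)])
    then have "i = k" "j = k" using \<open>a \<noteq> 0\<close> \<open>b \<noteq> 0\<close> by auto
    then have "u w = s k w"
      using ijk
      by (simp add: w_def dom.GL_add[OF u(1)] dom.GL_scale[OF u(1)] dom.scale_right_distrib mult.commute)
    then have "u w \<in> dom.span {w}" by (auto simp: dom.in_span_single)
    then show False using fix_iff[OF nz(4)] u'(5) by simp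
  qed
qed

lemma PGL_conjugation_inverse:
  assumes G: "\<And>z. z \<noteq> 0 \<Longrightarrow> G z \<noteq> 0 \<and> cod.span {F (G z)} = cod.span {z}"
  shows "PGL_conjugation s' s G"
proof
  show "G z \<noteq> 0" if "z \<noteq> 0" for z using G that by blast
  show eq: "dom.span {G x} = dom.span {G y} \<longleftrightarrow> cod.span {x} = cod.span {y}"
    if "x \<noteq> 0" "y \<noteq> 0" for x y
    using F_eq_iff[of "G x" "G y"] G that by auto
  show "\<exists>z. z \<noteq> 0 \<and> dom.span {G z} = dom.span {x}" if "x \<noteq> 0" for x
    using G[OF F_nonzero[OF that]] F_eq_iff[of "G (F x)" x] that F_nonzero[OF that] by auto
  have main: "dom.span {G (u' z)} = dom.span {u (G z)}"
    if u: "u \<in> GL s" and u': "u' \<in> GL s'" and z: "z \<noteq> 0"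
      and c: "\<forall>x. x \<noteq> 0 \<longrightarrow> cod.span {F (u x)} = cod.span {u' (F x)}" for u u' z
  proof -
    have nz: "G z \<noteq> 0" "u (G z) \<noteq> 0" "u' z \<noteq> 0" "G (u' z) \<noteq> 0"
      using G z dom.GL_eq_0_iff[OF u] cod.GL_eq_0_iff[OF u'] by auto
    have "cod.span {F (u (G z))} = u' ` cod.span {F (G z)}"
      using c nz by (simp add: cod.GL_image_span[OF u'])
    also have "\<dots> = cod.span {F (G (u' z))}"
      using G z nz by (simp add: cod.GL_image_span[OF u'])
    finally show ?thesis using F_eq_iff nz by simp
  qed
  show "\<exists>u\<in>GL s. \<forall>z. z \<noteq> 0 \<longrightarrow> dom.span {G (u' z)} = dom.span {u (G z)}" if "u' \<in> GL s'" for u'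
    using conj_inv[OF that] main[OF _ that] by blast
  show "\<exists>u'\<in>GL s'. \<forall>z. z \<noteq> 0 \<longrightarrow> dom.span {G (u' z)} = dom.span {u (G z)}" if "u \<in> GL s" for u
    using conj[OF that] main[OF that] by blast
qed

lemma F_collinear_iff:
  assumes nz: "x \<noteq> 0" "y \<noteq> 0" "z \<noteq> 0"
  shows "F z \<in> cod.span {F x, F y} \<longleftrightarrow> z \<in> dom.span {x, y}"
proof
  assume *: "F z \<in> cod.span {F x, F y}"
  obtain G where G: "\<And>z. z \<noteq> 0 \<Longrightarrow> G z \<noteq> 0 \<and> cod.span {F (G z)} = cod.span {z}"
    using F_surj by metis
  interpret inv: PGL_conjugation s' s G using G by (rule PGL_conjugation_inverse)
  have GF: "dom.span {G (F v)} = dom.span {v}" if "v \<noteq> 0" for v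
    using G[OF F_nonzero[OF that]] F_eq_iff[of "G (F v)" v] that by auto
  have "G (F z) \<in> dom.span {G (F x), G (F y)}"
    using * nz F_nonzero by (intro inv.F_collinear) auto
  also have "\<dots> = dom.span {x, y}" using GF nz by (intro dom.span_pair_cong) auto
  finally have "dom.span {G (F z)} \<subseteq> dom.span {x, y}"
    by (simp add: dom.span_minimal)
  then show "z \<in> dom.span {x, y}" using GF nz dom.span_base[of z "{z}"] by auto
qed (rule F_collinear[OF nz])

end

section \<open>The semilinear map in affine charts\<close>

text \<open>
An affine chart of the domain: the points \<open>e + h\<close> with \<open>\<phi> h = 0\<close> represent the complement of the
hyperplane \<open>\<phi> = 0\<close>. The vector \<open>h0\<close> witnesses that this hyperplane is not zero; its line is used
to read off the field homomorphism.
\<close>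
locale PGL_conjugation_chart = PGL_conjugation s s' F
  for s :: "'k::{real_normed_field,banach} \<Rightarrow> 'a::real_normed_vector \<Rightarrow> 'a"
    and s' :: "'k \<Rightarrow> 'b::real_normed_vector \<Rightarrow> 'b" and F +
  fixes e :: 'a and \<phi> :: "'a \<Rightarrow> 'k" and h0 :: 'a
  assumes \<phi>: "\<phi> \<in> dual s" and \<phi>_e: "\<phi> e = 1" and h0: "h0 \<noteq> 0" "\<phi> h0 = 0"
begin

lemmas \<phi>_simps = dual_add[OF \<phi>] dual_scale[OF \<phi>] dual_diff[OF \<phi>] dual_minus[OF \<phi>] dual_zero[OF \<phi>] \<phi>_e

text \<open>
The vectors on the images of the points of the hyperplane \<open>\<phi> = 0\<close>. It will be the hyperplane at
infinity of an affine chart of the codomain with origin \<open>F e\<close>.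
\<close>
definition H' :: "'b set" where
  "H' = {y. \<exists>h. h \<noteq> 0 \<and> \<phi> h = 0 \<and> y \<in> cod.span {F h}}"

lemma e_nonzero: "e \<noteq> 0"
  using \<phi>_e \<phi>_simps(5) by auto

lemma e_plus_nonzero:
  assumes "\<phi> h = 0" shows "e + h \<noteq> 0"
proof
  assume "e + h = 0"
  then have "\<phi> (e + h) = 0" by (simp add: \<phi>_simps)
  with assms show False by (simp add: \<phi>_simps)
qed

lemma F_in_H'_iff: "x \<noteq> 0 \<Longrightarrow> F x \<in> H' \<longleftrightarrow> \<phi> x = 0"
  unfolding H'_def using F_in_span_iff cod.span_base[of "F x" "{F x}"]
  by (auto simp: dom.in_span_single \<phi>_simps)

text \<open>
Closed under addition because collinearity is reflected: the sum of two vectors lies on a line of the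
form \<open>F x\<close>, and \<open>x\<close> is then in the span of two vectors of the hyperplane.
\<close>
lemma subspace_H': "cod.subspace H'"
  unfolding cod.subspace_def
proof (intro conjI ballI allI)
  show "0 \<in> H'" unfolding H'_def using h0 cod.span_zero by blast
  show "s' c y \<in> H'" if "y \<in> H'" for c y
    using that cod.span_scale unfolding H'_def by blast
  fix y1 y2 assume "y1 \<in> H'" "y2 \<in> H'"
  then obtain h1 h2 where h: "h1 \<noteq> 0" "\<phi> h1 = 0" "y1 \<in> cod.span {F h1}"
      "h2 \<noteq> 0" "\<phi> h2 = 0" "y2 \<in> cod.span {F h2}"
    unfolding H'_def by blast
  show "y1 + y2 \<in> H'"
  proof (cases "y1 + y2 = 0")
    case False
    then obtain x where x: "x \<noteq> 0" "cod.span {F x} = cod.span {y1 + y2}" using F_surj by blast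
    have "y1 \<in> cod.span {F h1, F h2}" "y2 \<in> cod.span {F h1, F h2}"
      using h cod.span_mono[of "{F h1}" "{F h1, F h2}"] cod.span_mono[of "{F h2}" "{F h1, F h2}"] by blast+
    then have "cod.span {y1 + y2} \<subseteq> cod.span {F h1, F h2}"
      by (simp add: cod.span_minimal cod.span_add)
    then have "F x \<in> cod.span {F h1, F h2}" using x(2) cod.span_base[of "F x" "{F x}"] by auto
    then have "x \<in> dom.span {h1, h2}" using F_collinear_iff x h by blast
    then have "\<phi> x = 0" using h by (auto simp: dom.in_span_pair \<phi>_simps)
    moreover have "y1 + y2 \<in> cod.span {F x}" using x(2) cod.span_base[of "y1 + y2" "{y1 + y2}"] by auto
    ultimately show ?thesis unfolding H'_def using x(1) by blast
  qed (simp add: \<open>0 \<in> H'\<close>)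
qed

text \<open>
\<open>H'\<close> has codimension one. The line of \<open>y\<close> is the image of the line of some \<open>x\<close>, which is
collinear with \<open>e\<close> and a point \<open>h\<close> of the hyperplane, and collinearity is preserved.
\<close>
lemma ex_chart:
  obtains c k where "k \<in> H'" "y = s' c (F e) + k"
proof (cases "y \<in> cod.span {F e}")
  case True
  then show ?thesis
    using that[of 0] cod.subspace_0[OF subspace_H'] by (auto simp: cod.in_span_single)
next
  case False
  then have "y \<noteq> 0" using cod.span_zero by auto
  then obtain x where x: "x \<noteq> 0" "cod.span {F x} = cod.span {y}" using F_surj by blast
  define h where "h = x - s (\<phi> x) e"
  have "h \<noteq> 0"
  proof
    assume "h = 0"
    then have "x \<in> dom.span {e}" by (auto simp: h_def dom.in_span_single)
    then have "F x \<in> cod.span {F e}" using F_in_span_iff x e_nonzero by blast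
    then have "cod.span {y} = cod.span {F e}" using cod.span_single_eq F_nonzero x by blast
    with False show False using cod.span_base[of y "{y}"] by auto
  qed
  have "x = s (\<phi> x) e + s 1 h" by (simp add: h_def)
  then have "x \<in> dom.span {e, h}" unfolding dom.in_span_pair by blast
  then have "F x \<in> cod.span {F e, F h}" using F_collinear x e_nonzero \<open>h \<noteq> 0\<close> by blast
  then have "cod.span {F x} \<subseteq> cod.span {F e, F h}" by (simp add: cod.span_minimal)
  then have "y \<in> cod.span {F e, F h}" using x cod.span_base[of y "{y}"] by auto
  then obtain c d where "y = s' c (F e) + s' d (F h)" by (auto simp: cod.in_span_pair)
  moreover have "F h \<in> H'" using F_in_H'_iff[OF \<open>h \<noteq> 0\<close>] by (simp add: h_def \<phi>_simps)
  ultimately show ?thesis using that cod.subspace_scale[OF subspace_H'] by blast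
qed

lemma chart_unique:
  assumes "s' a (F e) + k = s' b (F e) + k'" "k \<in> H'" "k' \<in> H'"
  shows "a = b \<and> k = k'"
proof -
  have "s' (a - b) (F e) = k' - k"
    using assms(1) by (simp add: cod.scale_left_diff_distrib algebra_simps)
  then have "s' (a - b) (F e) \<in> H'" using cod.subspace_diff[OF subspace_H'] assms by simp
  then have "s' (1 / (a - b)) (s' (a - b) (F e)) \<in> H'" by (rule cod.subspace_scale[OF subspace_H'])
  moreover have "F e \<notin> H'" using F_in_H'_iff[OF e_nonzero] \<phi>_e by simp
  ultimately have "a = b" by (cases "a = b") auto
  with assms(1) show ?thesis by simp
qed

text \<open>
The given map of projective spaces in the two affine charts. The uniqueness of the vector, which makes
the description legitimate, holds because \<open>F e\<close> does not belong to \<open>H'\<close>.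
\<close>
definition l :: "'a \<Rightarrow> 'b" where
  "l h = (THE k. k \<in> H' \<and> cod.span {F (e + h)} = cod.span {F e + k})"

lemma l_ex1:
  assumes h: "\<phi> h = 0"
  shows "\<exists>!k. k \<in> H' \<and> cod.span {F (e + h)} = cod.span {F e + k}"
proof -
  have nz: "e + h \<noteq> 0" using h by (rule e_plus_nonzero)
  obtain c k where k: "k \<in> H'" "F (e + h) = s' c (F e) + k" by (rule ex_chart)
  have "c \<noteq> 0"
    using k F_in_H'_iff[OF nz] h by (auto simp: \<phi>_simps)
  have "F (e + h) = s' c (F e + s' (1 / c) k)" using k \<open>c \<noteq> 0\<close> by (simp add: cod.scale_right_distrib)
  then have "F (e + h) \<in> cod.span {F e + s' (1 / c) k}" unfolding cod.in_span_single by blast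
  then have "cod.span {F (e + h)} = cod.span {F e + s' (1 / c) k}"
    using cod.span_single_eq F_nonzero[OF nz] by blast
  moreover have "s' (1 / c) k \<in> H'" using k cod.subspace_scale[OF subspace_H'] by blast
  moreover have "k1 = k2" if k: "k1 \<in> H'" "k2 \<in> H'" "cod.span {F e + k1} = cod.span {F e + k2}" for k1 k2
  proof -
    obtain a where "F e + k1 = s' a (F e + k2)"
      using k(3) cod.span_base[of "F e + k1" "{F e + k1}"] by (auto simp: cod.in_span_single)
    then have "s' 1 (F e) + k1 = s' a (F e) + s' a k2" by (simp add: cod.scale_right_distrib)
    moreover have "s' a k2 \<in> H'" using k(2) by (rule cod.subspace_scale[OF subspace_H'])
    ultimately have "1 = a \<and> k1 = s' a k2" using k(1) by (intro chart_unique) auto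
    then show ?thesis by simp
  qed
  ultimately show ?thesis by blast
qed

lemma l_in_H': "\<phi> h = 0 \<Longrightarrow> l h \<in> H'"
  and span_l: "\<phi> h = 0 \<Longrightarrow> cod.span {F (e + h)} = cod.span {F e + l h}"
  using theI'[OF l_ex1] unfolding l_def by auto

lemma l_eqI:
  assumes "\<phi> h = 0" "k \<in> H'" "cod.span {F (e + h)} = cod.span {F e + k}"
  shows "l h = k"
  using the1_equality[OF l_ex1[OF assms(1)]] assms(2,3) unfolding l_def by blast

lemma l_zero: "l 0 = 0"
  using cod.subspace_0[OF subspace_H'] by (intro l_eqI) (auto simp: \<phi>_simps)

lemma l_inj:
  assumes "\<phi> h = 0" "\<phi> k = 0" "l h = l k"
  shows "h = k"
proof -
  have "dom.span {e + h} = dom.span {e + k}"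
    using span_l[OF assms(1)] span_l[OF assms(2)] assms(3) F_eq_iff[OF e_plus_nonzero e_plus_nonzero, OF assms(1,2)]
    by simp
  then obtain c where c: "e + h = s c (e + k)"
    using dom.span_base[of "e + h" "{e + h}"] by (auto simp: dom.in_span_single)
  then have "\<phi> (e + h) = \<phi> (s c (e + k))" by simp
  with assms have "c = 1" by (simp add: \<phi>_simps)
  with c show ?thesis by simp
qed

lemma l_surj:
  assumes k: "k \<in> H'"
  shows "\<exists>h. \<phi> h = 0 \<and> l h = k"
proof -
  have nz: "F e + k \<noteq> 0"
    using chart_unique[of 1 k 0 0] k cod.subspace_0[OF subspace_H'] by auto
  obtain x where x: "x \<noteq> 0" "cod.span {F x} = cod.span {F e + k}" using F_surj[OF nz] by blast
  have "\<phi> x \<noteq> 0"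
  proof
    assume "\<phi> x = 0"
    then have "F x \<in> H'" using F_in_H'_iff x by simp
    then have "cod.span {F x} \<subseteq> H'" by (simp add: cod.span_minimal subspace_H')
    then have "F e + k \<in> H'" using x cod.span_base[of "F e + k" "{F e + k}"] by auto
    then have "F e \<in> H'" using cod.subspace_diff[OF subspace_H' _ k, of "F e + k"] by simp
    then show False using F_in_H'_iff[OF e_nonzero] \<phi>_e by simp
  qed
  define h where "h = s (1 / \<phi> x) x - e"
  have h: "\<phi> h = 0" using \<open>\<phi> x \<noteq> 0\<close> by (simp add: h_def \<phi>_simps)
  have "e + h = s (1 / \<phi> x) x" by (simp add: h_def)
  then have "e + h \<in> dom.span {x}" by (auto simp: dom.in_span_single)
  then have "dom.span {e + h} = dom.span {x}" using dom.span_single_eq e_plus_nonzero[OF h] by blast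
  then have "cod.span {F (e + h)} = cod.span {F e + k}" using F_eq_iff[OF e_plus_nonzero[OF h] x(1)] x(2) by simp
  then show ?thesis using l_eqI h k by blast
qed

lemma span_F_eq_span_l:
  assumes h: "\<phi> h = 0" "h \<noteq> 0"
  shows "cod.span {F h} = cod.span {l h}"
proof -
  have "s (- 1) e + s 1 (e + h) = h" by (simp add: dom.scale_minus_left)
  then have "h = s (- 1) e + s 1 (e + h)" by simp
  then have "h \<in> dom.span {e, e + h}" unfolding dom.in_span_pair by blast
  then have "F h \<in> cod.span {F e, F (e + h)}"
    using F_collinear h e_nonzero e_plus_nonzero by blast
  also have "\<dots> = cod.span {F e, F e + l h}" by (rule cod.span_pair_cong) (auto simp: span_l h)
  finally obtain a b where ab: "F h = s' a (F e) + s' b (F e + l h)" by (auto simp: cod.in_span_pair)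
  then have "s' 0 (F e) + F h = s' (a + b) (F e) + s' b (l h)"
    by (simp add: cod.scale_left_distrib cod.scale_right_distrib)
  moreover have "F h \<in> H'" "s' b (l h) \<in> H'"
    using F_in_H'_iff h l_in_H' cod.subspace_scale[OF subspace_H'] by auto
  ultimately have "F h = s' b (l h)" using chart_unique by blast
  then have "F h \<in> cod.span {l h}" by (auto simp: cod.in_span_single)
  then show ?thesis using cod.span_single_eq F_nonzero h by blast
qed

text \<open>
The linear map that fixes the hyperplane pointwise and sends \<open>e\<close> to a multiple of \<open>e + a\<close> acts on the
chart as the affine map \<open>h \<mapsto> a + r h\<close>. Its conjugate fixes all points of \<open>H'\<close>, hence is a scalar on
\<open>H'\<close>, and therefore acts on the other chart by a dilation followed by a translation. This is how additivity and
homogeneity are obtained without distinguishing dependent from independent vectors.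
\<close>
lemma l_affine:
  assumes a: "\<phi> a = 0" and r: "r \<noteq> 0"
  shows "\<exists>m. \<forall>h. \<phi> h = 0 \<longrightarrow> l (a + s r h) = l a + s' m (l h)"
proof -
  define u where "u x = x + s (\<phi> x) (s (1 / r) (e + a) - e)" for x
  have u: "u \<in> GL s"
    unfolding u_def
    by (rule dom.rank_one_perturbation_GL[OF \<phi>]) (use a r in \<open>simp add: \<phi>_simps\<close>)
  have u_H: "u h = h" if "\<phi> h = 0" for h using that by (simp add: u_def)
  have u_e: "u (e + h) = s (1 / r) (e + (a + s r h))" if "\<phi> h = 0" for h
    using that r by (simp add: u_def \<phi>_simps dom.scale_right_distrib)
  obtain u' where u': "u' \<in> GL s'" "\<And>x. x \<noteq> 0 \<Longrightarrow> cod.span {F (u x)} = cod.span {u' (F x)}"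
    using conj[OF u] by blast
  have "u' k \<in> cod.span {k}" if k: "k \<in> H'" for k
  proof -
    obtain h where h: "\<phi> h = 0" "l h = k" using l_surj[OF k] by blast
    show ?thesis
    proof (cases "h = 0")
      case False
      have "cod.span {k} = cod.span {F h}" using span_F_eq_span_l[OF h(1) False] h by simp
      also have "\<dots> = u' ` cod.span {F h}"
        unfolding cod.GL_image_span[OF u'(1)] using u'(2)[OF False] u_H[OF h(1)] by simp
      also have "\<dots> = cod.span {u' k}"
        using span_F_eq_span_l[OF h(1) False] h cod.GL_image_span[OF u'(1)] by simp
      finally show ?thesis using cod.span_base[of "u' k" "{u' k}"] by simp
    qed (use h l_zero cod.GL_zero[OF u'(1)] cod.span_zero in auto)
  qed
  then obtain c where c: "\<And>k. k \<in> H' \<Longrightarrow> u' k = s' c k"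
    using cod.eigenvectors_imp_scalar[OF cod.GL_add[OF u'(1)] cod.GL_scale[OF u'(1)] subspace_H'] by blast
  have span: "cod.span {u' (F e + l h)} = cod.span {F e + l (a + s r h)}" if h: "\<phi> h = 0" for h
  proof -
    have h': "\<phi> (a + s r h) = 0" using a h by (simp add: \<phi>_simps)
    have "cod.span {F e + l (a + s r h)} = cod.span {F (e + (a + s r h))}" using span_l[OF h'] by simp
    also have "\<dots> = cod.span {F (u (e + h))}"
    proof -
      have "u (e + h) \<noteq> 0" using dom.GL_eq_0_iff[OF u] e_plus_nonzero[OF h] by simp
      moreover have "u (e + h) \<in> dom.span {e + (a + s r h)}"
        using u_e[OF h] by (auto simp: dom.in_span_single)
      ultimately show ?thesis
        using dom.span_single_eq F_eq_iff e_plus_nonzero[OF h'] by metis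
    qed
    also have "\<dots> = u' ` cod.span {F (e + h)}"
      using u'(2)[OF e_plus_nonzero[OF h]] cod.GL_image_span[OF u'(1)] by simp
    also have "\<dots> = cod.span {u' (F e + l h)}"
      using span_l[OF h] cod.GL_image_span[OF u'(1)] by simp
    finally show ?thesis by simp
  qed
  obtain d where d: "u' (F e) = s' d (F e + l a)"
    using span[of 0] cod.span_base[of "u' (F e)" "{u' (F e)}"]
    by (auto simp: \<phi>_simps l_zero cod.in_span_single)
  have "d \<noteq> 0"
  proof
    assume "d = 0"
    with d have "u' (F e) = 0" by simp
    then show False using F_nonzero[OF e_nonzero] cod.GL_eq_0_iff[OF u'(1), of "F e"] by blast
  qed
  have "l (a + s r h) = l a + s' (c / d) (l h)" if h: "\<phi> h = 0" for h
  proof (rule l_eqI)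
    show in_H': "l a + s' (c / d) (l h) \<in> H'"
      using l_in_H' a h subspace_H' by (simp add: cod.subspace_add cod.subspace_scale)
    show "\<phi> (a + s r h) = 0" using a h by (simp add: \<phi>_simps)
    then have "cod.span {F (e + (a + s r h))} = cod.span {u' (F e + l h)}"
      using span_l span[OF h] by simp
    also have "u' (F e + l h) = s' d (F e + (l a + s' (c / d) (l h)))"
      using c[OF l_in_H'[OF h]] d \<open>d \<noteq> 0\<close>
      by (simp add: cod.GL_add[OF u'(1)] cod.scale_right_distrib add.assoc)
    also have "cod.span {\<dots>} = cod.span {F e + (l a + s' (c / d) (l h))}"
    proof (rule cod.span_single_eq)
      show "s' d (F e + (l a + s' (c / d) (l h))) \<in> cod.span {F e + (l a + s' (c / d) (l h))}"
        by (auto simp: cod.in_span_single)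
      show "s' d (F e + (l a + s' (c / d) (l h))) \<noteq> 0"
        using \<open>d \<noteq> 0\<close> chart_unique[of 1 "l a + s' (c / d) (l h)" 0 0] in_H'
          cod.subspace_0[OF subspace_H'] by auto
    qed
    finally show "cod.span {F (e + (a + s r h))} = cod.span {F e + (l a + s' (c / d) (l h))}" .
  qed
  then show ?thesis by blast
qed

text \<open>
For \<open>r = 1\<close> the conjugate must be a translation: a dilation factor \<open>m\<close> other than 1 would produce
a fixed point in the chart, but the translation by a nonzero \<open>a\<close> has none.
\<close>
lemma l_add:
  assumes a: "\<phi> a = 0" and h: "\<phi> h = 0"
  shows "l (a + h) = l a + l h"
proof (cases "a = 0")
  case False
  obtain m where m: "\<And>h. \<phi> h = 0 \<Longrightarrow> l (a + h) = l a + s' m (l h)"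
    using l_affine[OF a, of 1] by auto
  have "m = 1"
  proof (rule ccontr)
    assume "m \<noteq> 1"
    obtain k where k: "\<phi> k = 0" "l k = s' (1 / (1 - m)) (l a)"
      using l_surj[of "s' (1 / (1 - m)) (l a)"] l_in_H'[OF a] subspace_H' cod.subspace_scale by blast
    then have "s' (1 - m) (l k) = l a" using \<open>m \<noteq> 1\<close> by simp
    then have "l (a + k) = l k" using m[OF k(1)] by (simp add: cod.scale_left_diff_distrib diff_eq_eq)
    then have "a + k = k" using a k by (intro l_inj) (auto simp: \<phi>_simps)
    with False show False by simp
  qed
  with m[OF h] show ?thesis by simp
qed (simp add: l_zero)

lemma ex_l_scale: "\<exists>m. \<forall>h. \<phi> h = 0 \<longrightarrow> l (s r h) = s' m (l h)"
proof (cases "r = 0")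
  case True
  then show ?thesis by (intro exI[of _ 0]) (auto simp: l_zero)
next
  case False
  then show ?thesis using l_affine[of 0 r] by (simp add: \<phi>_simps l_zero)
qed

text \<open>
The fundamental theorem of projective geometry for this situation. The dilation factors define \<open>\<sigma>\<close>,
and \<open>l\<close> extends to the whole space by sending \<open>r e\<close> to \<open>\<sigma> r\<close> times \<open>F e\<close>.
\<close>
theorem ex_semilinear:
  "\<exists>L \<sigma>. bij L \<and> bij \<sigma> \<and> semilinear_wrt \<sigma> s s' L \<and> (\<forall>x. x \<noteq> 0 \<longrightarrow> cod.span {F x} = cod.span {L x})"
proof -
  obtain \<sigma> where \<sigma>: "\<And>r h. \<phi> h = 0 \<Longrightarrow> l (s r h) = s' (\<sigma> r) (l h)"
    using choice[of "\<lambda>r m. \<forall>h. \<phi> h = 0 \<longrightarrow> l (s r h) = s' m (l h)"] ex_l_scale by blast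
  have lh0: "l h0 \<noteq> 0" using l_inj[of h0 0] h0 l_zero by (auto simp: \<phi>_simps)
  have hom: "field_hom \<sigma>"
    unfolding field_hom_def
  proof (intro conjI allI)
    show "\<sigma> 1 = 1" using \<sigma>[OF h0(2), of 1] lh0 cod.scale_right_imp_eq[of "l h0" "\<sigma> 1" 1] by simp
    show "\<sigma> (a + b) = \<sigma> a + \<sigma> b" for a b
    proof -
      have "s' (\<sigma> (a + b)) (l h0) = s' (\<sigma> a + \<sigma> b) (l h0)"
        using l_add[of "s a h0" "s b h0"] h0 
        by (simp add: \<sigma>[symmetric] \<phi>_simps dom.scale_left_distrib cod.scale_left_distrib)
      then show ?thesis using lh0 by simp
    qed
    show "\<sigma> (a * b) = \<sigma> a * \<sigma> b" for a b
    proof -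
      have "s' (\<sigma> (a * b)) (l h0) = s' (\<sigma> a * \<sigma> b) (l h0)"
        using \<sigma>[of "s b h0" a] \<sigma>[OF h0(2), of b] \<sigma>[OF h0(2), of "a * b"] h0 by (simp add: \<phi>_simps)
      then show ?thesis using lh0 by simp
    qed
  qed
  have \<sigma>0: "\<sigma> r = 0 \<longleftrightarrow> r = 0" for r
    using \<sigma>[OF h0(2), of r] l_inj[of "s r h0" 0] h0 lh0 l_zero by (auto simp: \<phi>_simps)
  have "inj \<sigma>"
  proof (rule injI)
    fix a b assume "\<sigma> a = \<sigma> b"
    then have "l (s a h0) = l (s b h0)" using \<sigma> h0 by simp
    then show "a = b" using l_inj[of "s a h0" "s b h0"] h0 by (auto simp: \<phi>_simps)
  qed
  \<comment> \<open>every vector on the line of \<open>l h0\<close> has the form \<open>l h\<close>, and then \<open>h\<close> is on the line of \<open>h0\<close>\<close>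
  moreover have "\<exists>r. c = \<sigma> r" for c
  proof (cases "c = 0")
    case True
    then show ?thesis using \<sigma>0 by metis
  next
    case False
    obtain h where h: "\<phi> h = 0" "l h = s' c (l h0)"
      using l_surj[of "s' c (l h0)"] l_in_H'[OF h0(2)] subspace_H' cod.subspace_scale by blast
    then have "l h \<noteq> 0" using False lh0 by simp
    then have "h \<noteq> 0" using l_zero by auto
    have "l h \<in> cod.span {l h0}" using h by (auto simp: cod.in_span_single)
    then have "cod.span {F h} = cod.span {F h0}"
      using cod.span_single_eq[OF _ \<open>l h \<noteq> 0\<close>] span_F_eq_span_l h \<open>h \<noteq> 0\<close> h0 by metis
    then have "dom.span {h} = dom.span {h0}" using F_eq_iff \<open>h \<noteq> 0\<close> h0 by blast
    then obtain r where "h = s r h0" using dom.span_base[of h "{h}"] by (auto simp: dom.in_span_single)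
    then have "s' c (l h0) = s' (\<sigma> r) (l h0)" using h \<sigma>[OF h0(2), of r] by metis
    then show ?thesis using lh0 cod.scale_right_imp_eq by blast
  qed
  ultimately have bij: "bij \<sigma>" by (auto simp: bij_def surj_def)
  have \<sigma>_simps: "\<sigma> (a + b) = \<sigma> a + \<sigma> b" "\<sigma> (a * b) = \<sigma> a * \<sigma> b" "\<sigma> 1 = 1" for a b
    using hom by (auto simp: field_hom_def)
  define L where "L x = s' (\<sigma> (\<phi> x)) (F e) + l (x - s (\<phi> x) e)" for x
  have H: "\<phi> (x - s (\<phi> x) e) = 0" for x by (simp add: \<phi>_simps)
  have L_add: "L (x + y) = L x + L y" for x y
    using l_add[OF H[of x] H[of y]]
    by (simp add: L_def \<phi>_simps \<sigma>_simps dom.scale_left_distrib cod.scale_left_distrib algebra_simps)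
  have L_scale: "L (s c x) = s' (\<sigma> c) (L x)" for c x
    using \<sigma>[OF H[of x], of c]
    by (simp add: L_def \<phi>_simps \<sigma>_simps dom.scale_right_diff_distrib cod.scale_right_distrib)
  have L_e: "L (e + h) = F e + l h" if "\<phi> h = 0" for h
    using that by (simp add: L_def \<phi>_simps \<sigma>_simps)
  have L_h: "L h = l h" if "\<phi> h = 0" for h
    using that \<sigma>0 by (simp add: L_def)
  have semilinear: "semilinear_wrt \<sigma> s s' L"
    using hom L_add L_scale by (simp add: semilinear_wrt_def)
  have "x = y" if "L x = L y" for x y
  proof -
    have *: "\<sigma> (\<phi> x) = \<sigma> (\<phi> y) \<and> l (x - s (\<phi> x) e) = l (y - s (\<phi> y) e)"
      using that unfolding L_def by (rule chart_unique) (rule l_in_H'[OF H])+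
    then have "\<phi> x = \<phi> y" using bij_is_inj[OF bij] by (simp add: inj_eq)
    then show ?thesis using l_inj[OF H H, of x y] * by simp
  qed
  moreover have "\<exists>x. y = L x" for y
  proof -
    obtain c k where k: "k \<in> H'" "y = s' c (F e) + k" by (rule ex_chart)
    obtain h where h: "\<phi> h = 0" "l h = k" using l_surj[OF k(1)] by blast
    obtain r where "c = \<sigma> r" using bij_is_surj[OF bij] by (auto simp: surj_def)
    then have "y = L (s r e + h)" using h k by (simp add: L_def \<phi>_simps)
    then show ?thesis by blast
  qed
  ultimately have "bij L" by (auto simp: bij_def inj_def surj_def)
  moreover have "cod.span {F x} = cod.span {L x}" if x: "x \<noteq> 0" for x
  proof (cases "\<phi> x = 0")
    case True
    then show ?thesis using L_h span_F_eq_span_l x by simp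
  next
    case False
    define h where "h = s (1 / \<phi> x) x - e"
    have h: "\<phi> h = 0" using False by (simp add: h_def \<phi>_simps)
    have xh: "x = s (\<phi> x) (e + h)" using False by (simp add: h_def)
    then have "x \<in> dom.span {e + h}" by (auto simp: dom.in_span_single)
    then have "dom.span {x} = dom.span {e + h}" using dom.span_single_eq x by blast
    then have "cod.span {F x} = cod.span {F e + l h}"
      using F_eq_iff[OF x e_plus_nonzero[OF h]] span_l[OF h] by simp
    also have "L x = s' (\<sigma> (\<phi> x)) (F e + l h)"
      using L_scale[of "\<phi> x" "e + h"] L_e[OF h] xh by simp
    then have "L x \<in> cod.span {F e + l h}" by (auto simp: cod.in_span_single)
    moreover have "L x \<noteq> 0"
      using inj_eq[OF bij_is_inj[OF \<open>bij L\<close>], of x 0] x L_h[of 0] l_zero by (simp add: \<phi>_simps)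
    ultimately show ?thesis using cod.span_single_eq by auto
  qed
  ultimately show ?thesis using bij semilinear by blast
qed

end

section \<open>Continuity of the semilinear map\<close>

text \<open>
A field endomorphism fixes the rational numbers. If it changes the norm of some element, it increases the norm
of some \<open>b\<close>, possibly the inverse of that element; dividing \<open>b\<close> by a rational number between the two norms
gives an element whose powers tend to 0 while their images are unbounded.
\<close>
lemma small_argument_large_value:
  fixes \<sigma> :: "'k::real_normed_field \<Rightarrow> 'k"
  assumes \<sigma>: "field_hom \<sigma>" and c: "norm (\<sigma> c) \<noteq> norm c" and \<delta>: "0 < \<delta>"
  shows "\<exists>d. norm d \<le> \<delta> \<and> M \<le> norm (\<sigma> d)"
proof -
  have add: "\<sigma> (a + b) = \<sigma> a + \<sigma> b" and mult: "\<sigma> (a * b) = \<sigma> a * \<sigma> b" and one: "\<sigma> 1 = 1" for a b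
    using \<sigma> by (auto simp: field_hom_def)
  have zero: "\<sigma> 0 = 0" using add[of 0 0] by simp
  have of_nat: "\<sigma> (of_nat n) = of_nat n" for n by (induction n) (simp_all add: zero one add)
  have power: "\<sigma> (a ^ n) = \<sigma> a ^ n" for a n by (induction n) (simp_all add: one mult)
  have inverse: "\<sigma> (inverse a) = inverse (\<sigma> a)" for a
  proof (cases "a = 0")
    case False
    then have "\<sigma> (inverse a) * \<sigma> a = 1" using mult[of "inverse a" a] one by simp
    then show ?thesis using inverse_unique[of "\<sigma> a" "\<sigma> (inverse a)"] by (simp add: mult.commute)
  qed (simp add: zero)
  obtain b where b: "norm b < norm (\<sigma> b)"
  proof (cases "norm c < norm (\<sigma> c)")
    case False
    then have less: "norm (\<sigma> c) < norm c" using c by simp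
    then have "c \<noteq> 0" by auto
    then have "\<sigma> c \<noteq> 0" using mult[of "inverse c" c] one by auto
    then have "norm (inverse c) < norm (\<sigma> (inverse c))"
      using less \<open>c \<noteq> 0\<close> by (simp add: inverse norm_inverse)
    then show ?thesis by (rule that)
  qed (rule that)
  obtain q where q: "q \<in> \<rat>" "norm b < q" "q < norm (\<sigma> b)" using Rats_dense_in_real[OF b] by blast
  then have q0: "q > 0" by (meson le_less_trans norm_ge_zero)
  obtain m n :: nat where mn: "n \<noteq> 0" "\<bar>q\<bar> = real m / real n" using Rats_abs_nat_div_natE[OF q(1)] by metis
  then have qmn: "q = real m / real n" using q0 by simp
  then have "m \<noteq> 0" using q0 by (intro notI) simp
  define d where "d = b * (of_nat n * inverse (of_nat m))"
  have "norm d = norm b / q" "norm (\<sigma> d) = norm (\<sigma> b) / q"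
    unfolding d_def mult of_nat inverse norm_mult norm_inverse norm_of_nat qmn
    using mn(1) \<open>m \<noteq> 0\<close> by (simp_all add: field_simps)
  then have d: "norm d < 1" "1 < norm (\<sigma> d)" using q q0 by simp_all
  obtain k1 where k1: "norm d ^ k1 < \<delta>" using real_arch_pow_inv[OF \<delta> d(1)] by blast
  obtain k2 where k2: "M < norm (\<sigma> d) ^ k2" using real_arch_pow[OF d(2)] by blast
  have "norm (d ^ max k1 k2) \<le> \<delta>"
    using power_decreasing[of k1 "max k1 k2" "norm d"] d k1 by (simp add: norm_power)
  moreover have "M \<le> norm (\<sigma> (d ^ max k1 k2))"
  proof -
    have "norm (\<sigma> d) ^ k2 \<le> norm (\<sigma> d) ^ max k1 k2"
      by (rule power_increasing) (use d(2) in auto)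
    with k2 show ?thesis by (simp add: norm_power power)
  qed
  ultimately show ?thesis by blast
qed

lemma semilinear_wrt_inverse:
  assumes "bij l" "bij \<sigma>" "semilinear_wrt \<sigma> s s' l"
  shows "semilinear_wrt (inv \<sigma>) s' s (inv l)"
proof -
  have [simp]: "inv l (l x) = x" "l (inv l y) = y" for x y
    using assms(1) by (simp_all add: bij_is_inj bij_is_surj surj_f_inv_f)
  have [simp]: "inv \<sigma> (\<sigma> a) = a" "\<sigma> (inv \<sigma> a) = a" for a
    using assms(2) by (simp_all add: bij_is_inj bij_is_surj surj_f_inv_f)
  have add: "l (x + y) = l x + l y" and scale: "l (s a x) = s' (\<sigma> a) (l x)" for a x y
    using assms(3) by (auto simp: semilinear_wrt_def)
  have \<sigma>_add: "\<sigma> (a + b) = \<sigma> a + \<sigma> b" and \<sigma>_mult: "\<sigma> (a * b) = \<sigma> a * \<sigma> b"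
    and \<sigma>_one: "\<sigma> 1 = 1" for a b
    using assms(3) by (auto simp: semilinear_wrt_def field_hom_def)
  show ?thesis
    unfolding semilinear_wrt_def field_hom_def
  proof (intro conjI allI)
    show "inv \<sigma> 1 = 1" using arg_cong[OF \<sigma>_one, of "inv \<sigma>"] by simp
    show "inv \<sigma> (a + b) = inv \<sigma> a + inv \<sigma> b" for a b
      using arg_cong[OF \<sigma>_add[of "inv \<sigma> a" "inv \<sigma> b"], of "inv \<sigma>"] by simp
    show "inv \<sigma> (a * b) = inv \<sigma> a * inv \<sigma> b" for a b
      using arg_cong[OF \<sigma>_mult[of "inv \<sigma> a" "inv \<sigma> b"], of "inv \<sigma>"] by simp
    show "inv l (x + y) = inv l x + inv l y" for x y
      using arg_cong[OF add[of "inv l x" "inv l y"], of "inv l"] by simp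
    show "inv l (s' a x) = s (inv \<sigma> a) (inv l x)" for a x
      using arg_cong[OF scale[of "inv \<sigma> a" "inv l x"], of "inv l"] by simp
  qed
qed

text \<open>
The situation reached above, with the semilinear map itself as the choice of representatives. Both spaces
have to be infinite-dimensional for the assumptions to pass to the inverse map.
\<close>
locale PGL_semilinear =
  dom: norming_space s + cod: norming_space s'
  for s :: "'k::{real_normed_field,banach} \<Rightarrow> 'a::real_normed_vector \<Rightarrow> 'a"
    and s' :: "'k \<Rightarrow> 'b::real_normed_vector \<Rightarrow> 'b" +
  fixes L :: "'a \<Rightarrow> 'b" and \<sigma> :: "'k \<Rightarrow> 'k"
  assumes bij_L: "bij L" and bij_\<sigma>: "bij \<sigma>" and semilinear: "semilinear_wrt \<sigma> s s' L"
    and infinite_dom: "finite B \<Longrightarrow> dom.span B \<noteq> UNIV"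
    and infinite_cod: "finite B' \<Longrightarrow> cod.span B' \<noteq> UNIV"
    and conj: "u \<in> GL s \<Longrightarrow> \<exists>u'\<in>GL s'. \<forall>x. cod.span {L (u x)} = cod.span {u' (L x)}"
    and conj_inv: "u' \<in> GL s' \<Longrightarrow> \<exists>u\<in>GL s. \<forall>x. cod.span {L (u x)} = cod.span {u' (L x)}"
begin

lemma field_hom: "field_hom \<sigma>"
  and L_add: "L (x + y) = L x + L y" and L_scale: "L (s c x) = s' (\<sigma> c) (L x)"
  using semilinear by (auto simp: semilinear_wrt_def)

lemma \<sigma>_add: "\<sigma> (a + b) = \<sigma> a + \<sigma> b" and \<sigma>_mult: "\<sigma> (a * b) = \<sigma> a * \<sigma> b" and \<sigma>_one: "\<sigma> 1 = 1"
  using field_hom by (auto simp: field_hom_def)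

lemma L_zero: "L 0 = 0"
  using L_add[of 0 0] by simp

lemma L_eq_0_iff: "L x = 0 \<longleftrightarrow> x = 0"
  using inj_eq[OF bij_is_inj[OF bij_L], of x 0] by (simp add: L_zero)

lemma inv_L [simp]: "inv L (L x) = x" "L (inv L y) = y"
  using bij_L by (simp_all add: bij_is_inj bij_is_surj surj_f_inv_f)

lemma inv_\<sigma> [simp]: "inv \<sigma> (\<sigma> a) = a" "\<sigma> (inv \<sigma> a) = a"
  using bij_\<sigma> by (simp_all add: bij_is_inj bij_is_surj surj_f_inv_f)

lemma inv_semilinear: "semilinear_wrt (inv \<sigma>) s' s (inv L)"
  by (rule semilinear_wrt_inverse[OF bij_L bij_\<sigma> semilinear])

lemma inv_L_add: "inv L (x + y) = inv L x + inv L y"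
  and inv_L_scale: "inv L (s' c x) = s (inv \<sigma> c) (inv L x)"
  using inv_semilinear by (auto simp: semilinear_wrt_def)

lemma L_image_span: "L ` dom.span {x} = cod.span {L x}"
proof -
  have "L ` dom.span {x} = range (\<lambda>c. s' (\<sigma> c) (L x))"
    by (simp add: dom.span_singleton image_image L_scale)
  also have "\<dots> = (\<lambda>c. s' c (L x)) ` range \<sigma>" by auto
  finally show ?thesis using bij_is_surj[OF bij_\<sigma>] by (simp add: cod.span_singleton)
qed

lemma inverse: "PGL_semilinear s' s (inv L) (inv \<sigma>)"
proof
  show "bij (inv L)" "bij (inv \<sigma>)" using bij_L bij_\<sigma> by (simp_all add: bij_imp_bij_inv)
  show "semilinear_wrt (inv \<sigma>) s' s (inv L)" by (rule inv_semilinear)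
  have main: "dom.span {inv L (u' y)} = dom.span {u (inv L y)}"
    if c: "\<forall>x. cod.span {L (u x)} = cod.span {u' (L x)}" for u u' y
  proof -
    have "L ` dom.span {u (inv L y)} = L ` dom.span {inv L (u' y)}"
      using c[rule_format, of "inv L y"] by (simp add: L_image_span)
    then show ?thesis using bij_is_inj[OF bij_L] by (simp add: inj_image_eq_iff)
  qed
  show "\<exists>u\<in>GL s. \<forall>y. dom.span {inv L (u' y)} = dom.span {u (inv L y)}" if "u' \<in> GL s'" for u'
    using conj_inv[OF that] main by blast
  show "\<exists>u'\<in>GL s'. \<forall>y. dom.span {inv L (u' y)} = dom.span {u (inv L y)}" if "u \<in> GL s" for u
    using conj[OF that] main by blast
qed (use infinite_dom infinite_cod in auto)

text \<open>
The continuous functionals correspond under \<open>L\<close>, since they are visible in the group: with \<open>a\<close> in the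
kernel of \<open>\<phi>\<close>, the conjugate of the transvection \<open>x \<mapsto> x + \<phi> x a\<close> is, up to a scalar, in the general linear
group of the codomain, hence continuous. It is the transvection built from \<open>\<sigma> \<circ> \<phi> \<circ> inv L\<close> and \<open>L a\<close>.
\<close>
lemma dual_transport:
  assumes \<phi>: "\<phi> \<in> dual s"
  shows "(\<lambda>y. \<sigma> (\<phi> (inv L y))) \<in> dual s'"
proof (cases "\<forall>x. \<phi> x = 0")
  case True
  then have "(\<lambda>y. \<sigma> (\<phi> (inv L y))) = (\<lambda>y. 0)" using \<sigma>_add[of 0 0] by simp
  then show ?thesis by (auto intro: dualI[where C = 0])
next
  case False
  then obtain e where e: "\<phi> e \<noteq> 0" by blast
  obtain x where x: "x \<notin> dom.span {e}" using infinite_dom[of "{e}"] by auto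
  define a where "a = x - s (\<phi> x / \<phi> e) e"
  have a: "\<phi> a = 0" using e by (simp add: a_def dual_diff[OF \<phi>] dual_scale[OF \<phi>])
  have "a \<noteq> 0" using x unfolding a_def dom.in_span_single by auto
  define u where "u x = x + s (\<phi> x) a" for x
  have u: "u \<in> GL s" unfolding u_def by (rule dom.rank_one_perturbation_GL[OF \<phi>]) (simp add: a)
  obtain u' where u': "u' \<in> GL s'" "\<And>x. cod.span {L (u x)} = cod.span {u' (L x)}"
    using conj[OF u] by blast
  have inv_u: "u (inv u x) = x" for x using dom.GL_bij[OF u] by (simp add: bij_is_surj surj_f_inv_f)
  have inv_u': "inv u (u x) = x" for x using dom.GL_bij[OF u] by (simp add: bij_is_inj)
  have inv_u_add: "inv u (x + y) = inv u x + inv u y" for x y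
    using dom.GL_add[OF u, of "inv u x" "inv u y"] by (metis inv_u inv_u')
  have inv_u_scale: "inv u (s c x) = s c (inv u x)" for c x
    using dom.GL_scale[OF u, of c "inv u x"] by (metis inv_u inv_u')
  \<comment> \<open>two linear maps that induce the same map of points differ by a scalar\<close>
  have "\<exists>c. \<forall>y\<in>UNIV. u' (L (inv u (inv L y))) = s' c y"
  proof (rule cod.eigenvectors_imp_scalar)
    show "u' (L (inv u (inv L (x + y)))) = u' (L (inv u (inv L x))) + u' (L (inv u (inv L y)))" for x y
      by (simp add: inv_L_add inv_u_add L_add cod.GL_add[OF u'(1)])
    show "u' (L (inv u (inv L (s' c y)))) = s' c (u' (L (inv u (inv L y))))" for c y
      by (simp add: inv_L_scale inv_u_scale L_scale cod.GL_scale[OF u'(1)])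
    show "u' (L (inv u (inv L y))) \<in> cod.span {y}" for y
      using u'(2)[of "inv u (inv L y)"] cod.span_base[OF singletonI] by (simp add: inv_u)
  qed simp
  then obtain c where c: "\<And>y. u' (L (inv u (inv L y))) = s' c y" by blast
  have c_u: "u' (L x) = s' c (L (u x))" for x
    using c[of "L (u x)"] by (simp add: inv_u')
  have "c \<noteq> 0"
  proof
    assume "c = 0"
    then have "u' (L a) = 0" using c_u[of a] by simp
    then show False using \<open>a \<noteq> 0\<close> cod.GL_eq_0_iff[OF u'(1), of "L a"] L_eq_0_iff[of a] by blast
  qed
  obtain C where C: "\<And>y. norm (u' y) \<le> C * norm y" using cod.GL_bounded[OF u'(1)] by blast
  define K where "K = (C / norm c + 1) / norm (L a)"
  have La: "norm (L a) > 0" using \<open>a \<noteq> 0\<close> L_eq_0_iff by simp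
  show ?thesis
  proof (rule dualI[where C = K])
    fix y
    have "s' (\<sigma> (\<phi> (inv L y))) (L a) = s' (1 / c) (u' y) - y"
    proof -
      have "u' y = s' c (y + s' (\<sigma> (\<phi> (inv L y))) (L a))"
        using c_u[of "inv L y"] unfolding u_def L_add L_scale inv_L .
      with \<open>c \<noteq> 0\<close> show ?thesis by simp
    qed
    then have "norm (\<sigma> (\<phi> (inv L y))) * norm (L a) = norm (s' (1 / c) (u' y) - y)"
      by (metis cod.norm_s)
    also have "\<dots> \<le> norm (u' y) / norm c + norm y"
      using norm_triangle_ineq4[of "s' (1 / c) (u' y)" y] by (simp add: cod.norm_s norm_divide)
    also have "\<dots> \<le> (C / norm c + 1) * norm y"
      using C[of y] divide_right_mono[OF C[of y], of "norm c"] by (simp add: algebra_simps)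
    finally show "norm (\<sigma> (\<phi> (inv L y))) \<le> K * norm y"
      using La by (simp add: K_def field_simps)
  qed (simp_all add: inv_L_add inv_L_scale dual_add[OF \<phi>] dual_scale[OF \<phi>] \<sigma>_add \<sigma>_mult)
qed

lemma dual_transport_inv:
  assumes "\<phi>' \<in> dual s'"
  shows "(\<lambda>x. inv \<sigma> (\<phi>' (L x))) \<in> dual s"
proof -
  interpret inv: PGL_semilinear s' s "inv L" "inv \<sigma>" by (rule inverse)
  show ?thesis using inv.dual_transport[OF assms] by (simp add: inv_inv_eq bij_L)
qed

text \<open>
This is the step where infinite dimension is essential: in finite dimension wild automorphisms of the
complex numbers do induce conjugations of the projective groups. If \<open>\<sigma>\<close> is not isometric, it has large values
at small arguments. Choose inductively vectors \<open>x n\<close> and functionals \<open>\<theta> n\<close> with summable bounds, where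
\<open>\<theta> n\<close> vanishes at all earlier \<open>x m\<close> and its value at \<open>x n\<close> is small but makes the norm of \<open>\<sigma>\<close> of the partial sum at \<open>x n\<close>
at least \<open>n\<close> times \<open>norm (L (x n))\<close>. The later functionals do not disturb this value, so the transport of
\<open>\<psi> = \<Sum>n. \<theta> n\<close> is unbounded.
\<close>
lemma norm_\<sigma>: "norm (\<sigma> c) = norm c"
proof (rule ccontr)
  assume "norm (\<sigma> c) \<noteq> norm c"
  then have wild: "\<exists>d. norm d \<le> \<delta> \<and> M \<le> norm (\<sigma> d)" if "0 < \<delta>" for \<delta> M
    using small_argument_large_value[OF field_hom] that by blast
  define P where "P f n r \<longleftrightarrow> (\<forall>m<n. snd r (fst (f m)) = 0) \<and> snd r \<in> dual s \<and> fst r \<noteq> 0 \<and>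
      (\<forall>y. norm (snd r y) \<le> (1/2) ^ n * norm y) \<and>
      real n * norm (L (fst r)) \<le> norm (\<sigma> ((\<Sum>m<n. snd (f m) (fst r)) + snd r (fst r)))"
    for f :: "nat \<Rightarrow> 'a \<times> ('a \<Rightarrow> 'k)" and n r
  have "\<exists>f. \<forall>n. P f n (f n)"
  proof (rule dependent_wellorder_choice)
    show "P f n r = P g n r" if "\<And>m. m < n \<Longrightarrow> f m = g m" for r f g n
      using that by (simp add: P_def)
    fix n and f :: "nat \<Rightarrow> 'a \<times> ('a \<Rightarrow> 'k)"
    define B where "B = (\<lambda>m. fst (f m)) ` {..<n}"
    obtain x where x: "x \<notin> dom.span B" using infinite_dom[of B] by (auto simp: B_def)
    then have "x \<noteq> 0" using dom.span_zero by auto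
    obtain \<phi> where \<phi>: "\<phi> \<in> dual s" "\<And>b. b \<in> B \<Longrightarrow> \<phi> b = 0" "\<phi> x = 1"
      using dom.ex_dual_separating[OF _ x] by (auto simp: B_def)
    obtain C where C: "C > 0" "\<And>y. norm (\<phi> y) \<le> C * norm y" using dual_bounded[OF \<phi>(1)] by blast
    define S where "S = (\<Sum>m<n. snd (f m) x)"
    obtain d where d: "norm d \<le> (1/2) ^ n / C" "real n * norm (L x) + norm (\<sigma> S) \<le> norm (\<sigma> d)"
      using wild[of "(1/2) ^ n / C"] C(1) by fastforce
    have "norm (\<sigma> d) \<le> norm (\<sigma> (S + d)) + norm (\<sigma> S)"
      using norm_triangle_ineq4[of "\<sigma> (S + d)" "\<sigma> S"] by (simp add: \<sigma>_add)
    moreover have "norm (d * \<phi> y) \<le> (1/2) ^ n * norm y" for y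
    proof -
      have "norm (d * \<phi> y) \<le> ((1/2) ^ n / C) * (C * norm y)"
        unfolding norm_mult using C by (intro mult_mono d) auto
      then show ?thesis using C(1) by simp
    qed
    ultimately have "P f n (x, \<lambda>y. d * \<phi> y)"
      using \<phi> \<open>x \<noteq> 0\<close> d(2) dual_cmult[OF \<phi>(1)] by (auto simp: P_def S_def[symmetric] B_def)
    then show "\<exists>r. P f n r" by blast
  qed
  then obtain f where f: "\<And>n. P f n (f n)" by blast
  define x \<theta> where "x n = fst (f n)" and "\<theta> n = snd (f n)" for n
  have \<theta>: "\<theta> n \<in> dual s" "norm (\<theta> n y) \<le> (1/2) ^ n * norm y" and x: "x n \<noteq> 0"
    and vanish: "m < n \<Longrightarrow> \<theta> n (x m) = 0"
    and large: "real n * norm (L (x n)) \<le> norm (\<sigma> (\<Sum>m<Suc n. \<theta> m (x n)))" for m n y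
    using f[of n] by (simp_all add: P_def x_def \<theta>_def)
  define \<psi> where "\<psi> y = (\<Sum>n. \<theta> n y)" for y
  have "\<psi> \<in> dual s" unfolding \<psi>_def by (rule dual_suminf[OF \<theta>]) simp
  then obtain C where C: "\<And>y. norm (\<sigma> (\<psi> (inv L y))) \<le> C * norm y"
    using dual_bounded[OF dual_transport] by blast
  have "real n \<le> C" for n
  proof -
    have "\<psi> (x n) = (\<Sum>m<Suc n. \<theta> m (x n))"
      unfolding \<psi>_def by (rule suminf_finite) (auto intro: vanish)
    then have "real n * norm (L (x n)) \<le> C * norm (L (x n))"
      using large[of n] C[of "L (x n)"] by simp
    then show ?thesis using x[of n] L_eq_0_iff by simp
  qed
  then show False using reals_Archimedean2[of C] by (meson not_le)
qed

text \<open>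
The uniform boundedness principle, by a gliding hump in the dual space: if \<open>L\<close> is unbounded, choose \<open>x n\<close> with
\<open>norm (L (x n))\<close> at least \<open>3 ^ n * n * norm (x n)\<close> and add \<open>\<plusminus> (1/3) ^ n\<close> times a functional that norms
\<open>L (x n)\<close>, with the sign that keeps the partial sum large there. All later terms together can undo at most
half of this, as the sum of the \<open>(1/3) ^ m\<close> over \<open>m > n\<close> is half of \<open>(1/3) ^ n\<close>. The resulting functional
has no continuous transport to the domain.
\<close>
lemma L_bounded: "\<exists>C. \<forall>x. norm (L x) \<le> C * norm x"
proof (rule ccontr)
  assume "\<not> ?thesis"
  then have unbounded: "\<exists>x. C * norm x < norm (L x)" for C by (meson not_le)
  define P where "P f n r \<longleftrightarrow> snd r \<in> dual s' \<and> fst r \<noteq> 0 \<and>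
      (\<forall>y. norm (snd r y) \<le> (1/3) ^ n * norm y) \<and>
      real n * norm (fst r) \<le> (1/3) ^ n * norm (L (fst r)) \<and>
      (1/3) ^ n * norm (L (fst r)) \<le> norm ((\<Sum>m<n. snd (f m) (L (fst r))) + snd r (L (fst r)))"
    for f :: "nat \<Rightarrow> 'a \<times> ('b \<Rightarrow> 'k)" and n r
  have "\<exists>f. \<forall>n. P f n (f n)"
  proof (rule dependent_wellorder_choice)
    show "P f n r = P g n r" if "\<And>m. m < n \<Longrightarrow> f m = g m" for r f g n
      using that by (simp add: P_def)
    fix n and f :: "nat \<Rightarrow> 'a \<times> ('b \<Rightarrow> 'k)"
    obtain x where x: "(3 ^ n * real n) * norm x < norm (L x)" using unbounded by blast
    then have "x \<noteq> 0" using L_zero by auto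
    have large: "real n * norm x \<le> (1/3) ^ n * norm (L x)"
      using x by (simp add: field_simps power_divide)
    obtain \<eta> where \<eta>: "\<eta> \<in> dual s'" "\<And>y. norm (\<eta> y) \<le> norm y" "\<eta> (L x) = of_real (norm (L x))"
      using cod.ex_norming by blast
    define S where "S = (\<Sum>m<n. snd (f m) (L x))"
    define t :: 'k where "t = of_real ((1/3) ^ n)"
    have t: "norm t = (1/3) ^ n" unfolding t_def norm_of_real by simp
    have "norm (2 * (t * \<eta> (L x))) \<le> norm (S + t * \<eta> (L x)) + norm (S - t * \<eta> (L x))"
      using norm_triangle_ineq4[of "S + t * \<eta> (L x)" "S - t * \<eta> (L x)"] by (simp add: algebra_simps)
    moreover have "norm (2 * (t * \<eta> (L x))) = 2 * ((1/3) ^ n * norm (L x))"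
      by (simp add: norm_mult t \<eta>(3))
    \<comment> \<open>one of the two signs works, by the triangle inequality\<close>
    ultimately obtain i :: 'k where i: "norm i = 1" "(1/3) ^ n * norm (L x) \<le> norm (S + (i * t) * \<eta> (L x))"
    proof (cases "(1/3) ^ n * norm (L x) \<le> norm (S + t * \<eta> (L x))")
      case True
      then show ?thesis using that[of 1] by simp
    next
      case False
      then show ?thesis
        using that[of "- 1"] \<open>norm (2 * (t * \<eta> (L x))) \<le> _\<close> \<open>norm (2 * (t * \<eta> (L x))) = _\<close> by simp
    qed
    have "norm (i * t * \<eta> y) \<le> (1/3) ^ n * norm y" for y
      using mult_left_mono[OF \<eta>(2)[of y], of "(1/3) ^ n"] by (simp add: norm_mult i t)
    then have "P f n (x, \<lambda>y. (i * t) * \<eta> y)"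
      using large \<open>x \<noteq> 0\<close> i(2) dual_cmult[OF \<eta>(1)] by (simp add: P_def S_def)
    then show "\<exists>r. P f n r" by blast
  qed
  then obtain f where f: "\<And>n. P f n (f n)" by blast
  define x \<theta> where "x n = fst (f n)" and "\<theta> n = snd (f n)" for n
  have \<theta>: "\<theta> n \<in> dual s'" "norm (\<theta> n y) \<le> (1/3) ^ n * norm y" and x: "x n \<noteq> 0"
    and large: "real n * norm (x n) \<le> (1/3) ^ n * norm (L (x n))"
      "(1/3) ^ n * norm (L (x n)) \<le> norm (\<Sum>m<Suc n. \<theta> m (L (x n)))" for n y
    using f[of n] by (simp_all add: P_def x_def \<theta>_def)
  define \<psi> where "\<psi> y = (\<Sum>n. \<theta> n y)" for y
  have "\<psi> \<in> dual s'" unfolding \<psi>_def by (rule dual_suminf[OF \<theta>]) simp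
  then obtain C where C: "\<And>y. norm (inv \<sigma> (\<psi> (L y))) \<le> C * norm y"
    using dual_bounded[OF dual_transport_inv] by blast
  have summable: "summable (\<lambda>n. \<theta> n y)" for y by (rule dual_suminf[OF \<theta>]) simp
  have "real n \<le> 2 * C" for n
  proof -
    define y where "y = L (x n)"
    have "norm (\<Sum>m. \<theta> (m + Suc n) y) \<le> (1/2) * ((1/3) ^ n * norm y)"
    proof -
      have geom: "(\<lambda>m. (1/3::real) ^ m * ((1/3) ^ Suc n * norm y)) sums
          ((1 / (1 - 1/3)) * ((1/3) ^ Suc n * norm y))"
        by (intro sums_mult2 geometric_sums) simp
      have bound: "norm (\<theta> (m + Suc n) y) \<le> (1/3) ^ m * ((1/3) ^ Suc n * norm y)" for m
        using \<theta>(2)[of "m + Suc n" y] by (simp add: power_add mult.assoc)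
      have "norm (\<Sum>m. \<theta> (m + Suc n) y) \<le> (\<Sum>m. (1/3) ^ m * ((1/3) ^ Suc n * norm y))"
        by (rule norm_suminf_le[OF bound sums_summable[OF geom]])
      also have "\<dots> = (1 / (1 - 1/3)) * ((1/3) ^ Suc n * norm y)"
        by (rule sums_unique[OF geom, symmetric])
      finally show ?thesis by (simp add: mult.commute)
    qed
    moreover have "\<psi> y = (\<Sum>m. \<theta> (m + Suc n) y) + (\<Sum>m<Suc n. \<theta> m y)"
      unfolding \<psi>_def by (rule suminf_split_initial_segment[OF summable])
    then have "norm (\<Sum>m<Suc n. \<theta> m y) \<le> norm (\<psi> y) + norm (\<Sum>m. \<theta> (m + Suc n) y)"
      using norm_triangle_ineq4[of "\<psi> y" "\<Sum>m. \<theta> (m + Suc n) y"] by simp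
    ultimately have "(1/2) * ((1/3) ^ n * norm y) \<le> norm (\<psi> y)"
      using large(2)[of n] by (simp add: y_def)
    also have "\<dots> = norm (inv \<sigma> (\<psi> y))" using norm_\<sigma>[of "inv \<sigma> (\<psi> y)"] by simp
    also have "\<dots> \<le> C * norm (x n)" using C[of "x n"] by (simp add: y_def)
    finally have "real n * norm (x n) \<le> (2 * C) * norm (x n)" using large(1)[of n] by (simp add: y_def)
    then show ?thesis using x[of n] by simp
  qed
  then show False using reals_Archimedean2[of "2 * C"] by (meson not_le)
qed

theorem L_homeomorphism: "homeomorphism UNIV UNIV L (inv L)"
proof -
  interpret inv: PGL_semilinear s' s "inv L" "inv \<sigma>" by (rule inverse)
  have "continuous_on UNIV L" using L_bounded L_add additive_bounded_imp_continuous by metis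
  moreover have "continuous_on UNIV (inv L)" using inv.L_bounded inv.L_add additive_bounded_imp_continuous by metis
  ultimately show ?thesis
    using bij_is_surj[OF bij_L] bij_is_surj[OF bij_imp_bij_inv[OF bij_L]] by (simp add: homeomorphism_def)
qed

end

section \<open>The characterization\<close>

text \<open>
A finite spanning set contains a finite basis.
\<close>
lemma infinite_dimensional_no_finite_spanning_set:
  assumes "infinite_dimensional s" "finite B"
  shows "module.span s B \<noteq> UNIV"
proof
  assume span: "module.span s B = UNIV"
  interpret vector_space s using assms(1) by (simp add: infinite_dimensional_def)
  obtain B' where B': "B' \<subseteq> B" "independent B'" "B \<subseteq> span B'"
    using maximal_independent_subset[of B] by blast
  have "span B' = UNIV" using span B'(3) span_minimal[OF B'(3) subspace_span] by auto
  moreover have "finite B'" using B'(1) assms(2) by (rule finite_subset)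
  ultimately have "finite_dimensional_vector_space s B'"
    using B'(2) by unfold_locales
  then show False using assms(1) by (auto simp: infinite_dimensional_def)
qed

lemma semilinear_homeomorphism_inverse:
  assumes "semilinear_homeomorphism s s' l"
  shows "semilinear_homeomorphism s' s (inv l)"
proof -
  obtain \<sigma> where l: "bij l" "homeomorphism UNIV UNIV l (inv l)" and \<sigma>: "bij \<sigma>" "semilinear_wrt \<sigma> s s' l"
    using assms by (auto simp: semilinear_homeomorphism_def semilinear_isomorphism_def)
  have "homeomorphism UNIV UNIV (inv l) (inv (inv l))"
    using homeomorphism_symD[OF l(2)] by (simp add: inv_inv_eq l(1))
  then show ?thesis
    using semilinear_wrt_inverse[OF l(1) \<sigma>] l(1) \<sigma>(1)
    unfolding semilinear_homeomorphism_def semilinear_isomorphism_def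
    by (blast intro: bij_imp_bij_inv)
qed

text \<open>
The conjugate of a linear map by a semilinear one is linear, since the field automorphism cancels.
\<close>
lemma GL_conjugate:
  assumes l: "semilinear_homeomorphism s s' l" and s': "vector_space s'" and u: "u \<in> GL s"
  shows "l \<circ> u \<circ> inv l \<in> GL s'"
proof -
  obtain \<sigma> where hl: "bij l" "homeomorphism UNIV UNIV l (inv l)" and \<sigma>: "bij \<sigma>" "semilinear_wrt \<sigma> s s' l"
    using l by (auto simp: semilinear_homeomorphism_def semilinear_isomorphism_def)
  obtain \<tau> where \<tau>: "semilinear_wrt \<tau> s' s (inv l)"
    using semilinear_homeomorphism_inverse[OF l]
    by (auto simp: semilinear_homeomorphism_def semilinear_isomorphism_def)
  have inv: "l (inv l y) = y" for y using hl(1) by (simp add: bij_is_surj surj_f_inv_f)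
  have hu: "bij u" "homeomorphism UNIV UNIV u (inv u)" "\<And>x y. u (x + y) = u x + u y" "\<And>c x. u (s c x) = s c (u x)"
    using u by (auto simp: GL_def Vector_Spaces.linear_iff)
  have bij: "bij (l \<circ> u \<circ> inv l)"
    using hl(1) hu(1) by (intro bij_comp bij_imp_bij_inv)
  have inv_eq: "inv (l \<circ> u \<circ> inv l) = l \<circ> (inv u \<circ> inv l)"
    using hl(1) hu(1) by (simp add: o_inv_distrib bij_comp bij_imp_bij_inv inv_inv_eq)
  have "homeomorphism UNIV UNIV (l \<circ> u \<circ> inv l) (inv (l \<circ> u \<circ> inv l))"
  proof -
    have "homeomorphism UNIV UNIV (l \<circ> u \<circ> inv l) (l \<circ> (inv u \<circ> inv l))"
      using homeomorphism_compose[OF homeomorphism_symD[OF hl(2)] homeomorphism_compose[OF hu(2) hl(2)]]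
      by (simp add: comp_assoc)
    then show ?thesis by (simp add: inv_eq)
  qed
  moreover have "(l \<circ> u \<circ> inv l) (s' c y) = s' c ((l \<circ> u \<circ> inv l) y)" for c y
  proof -
    have l_scale: "l (s a x) = s' (\<sigma> a) (l x)" for a x using \<sigma>(2) by (simp add: semilinear_wrt_def)
    have "inv l (s' c y) = s (inv \<sigma> c) (inv l y)"
      using l_scale[of "inv \<sigma> c" "inv l y"] inv hl(1) \<sigma>(1)
      by (metis bij_inv_eq_iff)
    then show ?thesis using l_scale \<sigma>(1) by (simp add: hu(4) bij_is_surj surj_f_inv_f)
  qed
  moreover have "(l \<circ> u \<circ> inv l) (x + y) = (l \<circ> u \<circ> inv l) x + (l \<circ> u \<circ> inv l) y" for x y
    using \<sigma>(2) \<tau> by (simp add: semilinear_wrt_def hu(3))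
  ultimately show ?thesis
    using bij s' by (simp add: GL_def Vector_Spaces.linear_iff)
qed

lemma (in normed_space) GL_image_proj_space:
  assumes u: "u \<in> GL s" and P: "P \<in> proj_space s" shows "u ` P \<in> proj_space s"
proof -
  obtain x where "x \<noteq> 0" "P = span {x}" using P by (auto simp: proj_space_iff)
  then have "u x \<noteq> 0" "u ` P = span {u x}" using GL_image_span[OF u] GL_eq_0_iff[OF u] by simp_all
  then show ?thesis unfolding proj_space_iff by blast
qed

lemma GL_imp_PGL: "u \<in> GL s \<Longrightarrow> (\<lambda>P\<in>proj_space s. u ` P) \<in> PGL s"
  unfolding PGL_def by blast

lemma induced_imp_PGLc_mapping:
  assumes s: "normed_space s" and s': "normed_space s'" and l: "semilinear_homeomorphism s s' l"
    and f: "f \<in> proj_space s \<rightarrow> proj_space s'" and induced: "induced_by s f l"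
  shows "PGLc_mapping s s' f"
  unfolding PGLc_mapping_def
proof (intro conjI ballI f)
  interpret s: normed_space s by fact
  interpret s': normed_space s' by fact
  fix h assume "h \<in> PGL s"
  then obtain u where u: "u \<in> GL s" and h: "h = (\<lambda>P\<in>proj_space s. u ` P)" by (auto simp: PGL_def)
  have PGL: "(\<lambda>Q\<in>proj_space s'. (l \<circ> u \<circ> inv l) ` Q) \<in> PGL s'"
    using GL_conjugate[OF l s'.vector_space_axioms u] by (rule GL_imp_PGL)
  have "bij l" using l by (auto simp: semilinear_homeomorphism_def semilinear_isomorphism_def)
  show "\<exists>h'\<in>PGL s'. \<forall>P\<in>proj_space s. f (h P) = h' (f P)"
  proof (rule bexI[OF _ PGL], rule ballI)
    fix P assume P: "P \<in> proj_space s"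
    have "f (h P) = l ` u ` P"
      using P s.GL_image_proj_space[OF u P] induced by (simp add: h induced_by_def)
    also have "\<dots> = (l \<circ> u \<circ> inv l) ` f P"
      using induced P bij_is_inj[OF \<open>bij l\<close>] by (simp add: induced_by_def image_image)
    also have "\<dots> = (\<lambda>Q\<in>proj_space s'. (l \<circ> u \<circ> inv l) ` Q) (f P)"
      using f P by auto
    finally show "f (h P) = (\<lambda>Q\<in>proj_space s'. (l \<circ> u \<circ> inv l) ` Q) (f P)" .
  qed
qed

lemma induced_by_inverse:
  assumes f: "bij_betw f (proj_space s) (proj_space s')" and "bij l" and induced: "induced_by s f l"
  shows "induced_by s' (inv_into (proj_space s) f) (inv l)"
  unfolding induced_by_def
proof
  fix Q assume Q: "Q \<in> proj_space s'"
  define P where "P = inv_into (proj_space s) f Q"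
  have "P \<in> proj_space s" "f P = Q"
    using f Q by (auto simp: P_def bij_betw_def inv_into_into f_inv_into_f)
  then have "Q = l ` P" using induced by (simp add: induced_by_def)
  then have "inv l ` Q = P" using bij_is_inj[OF \<open>bij l\<close>] by (simp add: image_inv_f_f)
  then show "inv_into (proj_space s) f Q = inv l ` Q" unfolding P_def ..
qed

text \<open>
The chart is centred at an arbitrary \<open>e\<close>, with a functional \<open>\<phi>\<close> that is 1 at \<open>e\<close>; a vector outside the line of \<open>e\<close>
provides a nonzero element of the kernel of \<open>\<phi>\<close>. The semilinear map that results represents the same map of
points as \<open>F\<close>, so it inherits the conjugation property.
\<close>
lemma PGLc_imp_induced:
  fixes s :: "'k::{real_normed_field,banach} \<Rightarrow> 'a::real_normed_vector \<Rightarrow> 'a"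
    and s' :: "'k \<Rightarrow> 'b::real_normed_vector \<Rightarrow> 'b"
  assumes s: "norming_space s" and s': "norming_space s'"
    and inf: "infinite_dimensional s" "infinite_dimensional s'"
    and f: "bij_betw f (proj_space s) (proj_space s')"
    and PGLc: "PGLc_mapping s s' f" "PGLc_mapping s' s (inv_into (proj_space s) f)"
  shows "\<exists>l. semilinear_homeomorphism s s' l \<and> induced_by s f l"
proof -
  interpret dom: norming_space s by fact
  interpret cod: norming_space s' by fact
  note infinite = infinite_dimensional_no_finite_spanning_set[OF inf(1)]
    infinite_dimensional_no_finite_spanning_set[OF inf(2)]
  have line: "dom.span {x} \<in> proj_space s" if "x \<noteq> 0" for x
    using that by (auto simp: dom.proj_space_iff)
  have line': "cod.span {y} \<in> proj_space s'" if "y \<noteq> 0" for y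
    using that by (auto simp: cod.proj_space_iff)
  have "\<exists>y. y \<noteq> 0 \<and> f (dom.span {x}) = cod.span {y}" if "x \<noteq> 0" for x
    using bij_betwE[OF f] line[OF that] by (auto simp: cod.proj_space_iff)
  then obtain F where F: "\<And>x. x \<noteq> 0 \<Longrightarrow> F x \<noteq> 0" "\<And>x. x \<noteq> 0 \<Longrightarrow> f (dom.span {x}) = cod.span {F x}"
    by metis
  have apply_PGL: "f (dom.span {u x}) = cod.span {F (u x)} \<and> u ` dom.span {x} = dom.span {u x}"
    if "u \<in> GL s" "x \<noteq> 0" for u x
    using F(2) dom.GL_eq_0_iff[OF that(1)] dom.GL_image_span[OF that(1)] that(2) by auto
  interpret PGL_conjugation s s' F
  proof
    show "F x \<noteq> 0" if "x \<noteq> 0" for x using F(1)[OF that] .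
    show "cod.span {F x} = cod.span {F y} \<longleftrightarrow> dom.span {x} = dom.span {y}" if "x \<noteq> 0" "y \<noteq> 0" for x y
      using inj_on_eq_iff[OF bij_betw_imp_inj_on[OF f] line line, OF that] by (simp add: F(2) that)
    show "\<exists>x. x \<noteq> 0 \<and> cod.span {F x} = cod.span {z}" if z: "z \<noteq> 0" for z
    proof -
      have "cod.span {z} \<in> f ` proj_space s"
        using line'[OF z] bij_betw_imp_surj_on[OF f] by simp
      then obtain P where P: "P \<in> proj_space s" "f P = cod.span {z}" by auto
      then obtain x where x: "x \<noteq> 0" "P = dom.span {x}" by (auto simp: dom.proj_space_iff)
      with P have "cod.span {F x} = cod.span {z}" using F(2)[OF x(1)] by simp
      with x show ?thesis by blast
    qed
    show "\<exists>u'\<in>GL s'. \<forall>x. x \<noteq> 0 \<longrightarrow> cod.span {F (u x)} = cod.span {u' (F x)}" if u: "u \<in> GL s" for u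
    proof -
      obtain h' where h': "h' \<in> PGL s'" "\<And>P. P \<in> proj_space s \<Longrightarrow> f ((\<lambda>P\<in>proj_space s. u ` P) P) = h' (f P)"
        using PGLc(1) GL_imp_PGL[OF u] unfolding PGLc_mapping_def by blast
      then obtain u' where u': "u' \<in> GL s'" "h' = (\<lambda>Q\<in>proj_space s'. u' ` Q)" by (auto simp: PGL_def)
      have "cod.span {F (u x)} = cod.span {u' (F x)}" if x: "x \<noteq> 0" for x
      proof -
        have "cod.span {F (u x)} = f (u ` dom.span {x})" using apply_PGL[OF u x] by simp
        also have "\<dots> = u' ` f (dom.span {x})"
          using h'(2)[OF line[OF x]] line[OF x] line'[OF F(1)[OF x]] by (simp add: u'(2) F(2)[OF x])
        also have "\<dots> = cod.span {u' (F x)}" by (simp add: F(2)[OF x] cod.GL_image_span[OF u'(1)])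
        finally show ?thesis .
      qed
      with u' show ?thesis by blast
    qed
    show "\<exists>u\<in>GL s. \<forall>x. x \<noteq> 0 \<longrightarrow> cod.span {F (u x)} = cod.span {u' (F x)}" if u': "u' \<in> GL s'" for u'
    proof -
      let ?g = "inv_into (proj_space s) f"
      have fg: "f (?g Q) = Q" if "Q \<in> proj_space s'" for Q
        using that f by (simp add: bij_betw_def f_inv_into_f)
      have gf: "?g (f P) = P" if "P \<in> proj_space s" for P
        using that f by (simp add: bij_betw_def)
      obtain h where h: "h \<in> PGL s" "\<And>Q. Q \<in> proj_space s' \<Longrightarrow> ?g ((\<lambda>Q\<in>proj_space s'. u' ` Q) Q) = h (?g Q)"
        using PGLc(2) GL_imp_PGL[OF u'] unfolding PGLc_mapping_def by blast
      then obtain u where u: "u \<in> GL s" "h = (\<lambda>P\<in>proj_space s. u ` P)" by (auto simp: PGL_def)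
      have "cod.span {F (u x)} = cod.span {u' (F x)}" if x: "x \<noteq> 0" for x
      proof -
        have nz: "u' (F x) \<noteq> 0" using F(1)[OF x] cod.GL_eq_0_iff[OF u'] by blast
        have "cod.span {F (u x)} = f (u ` dom.span {x})" using apply_PGL[OF u(1) x] by simp
        also have "u ` dom.span {x} = ?g (u' ` f (dom.span {x}))"
          using h(2)[OF line'[OF F(1)[OF x]]] line[OF x] line'[OF F(1)[OF x]] gf[OF line[OF x]]
          by (simp add: u(2) F(2)[OF x])
        also have "f \<dots> = cod.span {u' (F x)}"
          using fg[OF line'[OF nz]] by (simp add: F(2)[OF x] cod.GL_image_span[OF u'])
        finally show ?thesis .
      qed
      with u show ?thesis by blast
    qed
  qed
  obtain e where "e \<notin> dom.span {}" using infinite(1)[of "{}"] by auto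
  then obtain \<phi> where \<phi>: "\<phi> \<in> dual s" "\<phi> e = 1" using dom.ex_dual_separating[of "{}"] by blast
  obtain x where x: "x \<notin> dom.span {e}" using infinite(1)[of "{e}"] by auto
  define h0 where "h0 = x - s (\<phi> x) e"
  interpret PGL_conjugation_chart s s' F e \<phi> h0
  proof
    show "h0 \<noteq> 0" using x unfolding h0_def dom.in_span_single by auto
    show "\<phi> h0 = 0" using \<phi> by (simp add: h0_def dual_diff[OF \<phi>(1)] dual_scale[OF \<phi>(1)])
  qed (use \<phi> in auto)
  obtain L \<sigma> where L: "bij L" "bij \<sigma>" "semilinear_wrt \<sigma> s s' L"
      "\<And>x. x \<noteq> 0 \<Longrightarrow> cod.span {F x} = cod.span {L x}"
    using ex_semilinear by blast
  have L0: "L 0 = 0"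
  proof -
    have "L (0 + 0) = L 0 + L 0" using L(3) unfolding semilinear_wrt_def by blast
    then show ?thesis by simp
  qed
  have L_conj: "cod.span {L (u x)} = cod.span {u' (L x)}"
    if u: "u \<in> GL s" and u': "u' \<in> GL s'"
      and c: "\<forall>x. x \<noteq> 0 \<longrightarrow> cod.span {F (u x)} = cod.span {u' (F x)}" for u u' x
  proof (cases "x = 0")
    case True
    then show ?thesis using dom.GL_zero[OF u] cod.GL_zero[OF u'] L0 by simp
  next
    case False
    then have "u x \<noteq> 0" using dom.GL_eq_0_iff[OF u] by blast
    then have "cod.span {L (u x)} = cod.span {u' (F x)}" using L(4)[of "u x"] c False by simp
    also have "\<dots> = u' ` cod.span {F x}" by (rule cod.GL_image_span[OF u', symmetric])
    also have "\<dots> = cod.span {u' (L x)}" unfolding L(4)[OF False] by (rule cod.GL_image_span[OF u'])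
    finally show ?thesis .
  qed
  interpret PGL_semilinear s s' L \<sigma>
  proof
    show "\<exists>u'\<in>GL s'. \<forall>x. cod.span {L (u x)} = cod.span {u' (L x)}" if "u \<in> GL s" for u
      using conj[OF that] L_conj[OF that] by blast
    show "\<exists>u\<in>GL s. \<forall>x. cod.span {L (u x)} = cod.span {u' (L x)}" if "u' \<in> GL s'" for u'
      using conj_inv[OF that] L_conj[OF _ that] by blast
  qed (use L infinite in auto)
  have "semilinear_homeomorphism s s' L"
    using L L_homeomorphism unfolding semilinear_homeomorphism_def semilinear_isomorphism_def by blast
  moreover have "induced_by s f L"
    unfolding induced_by_def
  proof
    fix P assume "P \<in> proj_space s"
    then obtain x where x: "x \<noteq> 0" "P = dom.span {x}" by (auto simp: dom.proj_space_iff)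
    then show "f P = L ` P" by (simp add: F(2) L(4) L_image_span)
  qed
  ultimately show ?thesis by blast
qed

theorem induced_iff_PGLc:
  fixes s :: "'k::{real_normed_field,banach} \<Rightarrow> 'a::real_normed_vector \<Rightarrow> 'a"
    and s' :: "'k \<Rightarrow> 'b::real_normed_vector \<Rightarrow> 'b"
  assumes s: "norming_space s" and s': "norming_space s'"
    and inf: "infinite_dimensional s" "infinite_dimensional s'"
    and f: "bij_betw f (proj_space s) (proj_space s')"
  shows "(\<exists>l. semilinear_homeomorphism s s' l \<and> induced_by s f l) \<longleftrightarrow>
    PGLc_mapping s s' f \<and> PGLc_mapping s' s (inv_into (proj_space s) f)"
proof
  assume "\<exists>l. semilinear_homeomorphism s s' l \<and> induced_by s f l"
  then obtain l where l: "semilinear_homeomorphism s s' l" "induced_by s f l" by blast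
  interpret dom: norming_space s by fact
  interpret cod: norming_space s' by fact
  have "bij l" using l(1) by (auto simp: semilinear_homeomorphism_def semilinear_isomorphism_def)
  have "PGLc_mapping s s' f"
    using dom.normed_space_axioms cod.normed_space_axioms l(1) _ l(2)
    by (rule induced_imp_PGLc_mapping) (use bij_betwE[OF f] in auto)
  moreover have "PGLc_mapping s' s (inv_into (proj_space s) f)"
    using cod.normed_space_axioms dom.normed_space_axioms semilinear_homeomorphism_inverse[OF l(1)] _
      induced_by_inverse[OF f \<open>bij l\<close> l(2)]
    by (rule induced_imp_PGLc_mapping) (use bij_betwE[OF bij_betw_inv_into[OF f]] in auto)
  ultimately show "PGLc_mapping s s' f \<and> PGLc_mapping s' s (inv_into (proj_space s) f)" ..
qed (use PGLc_imp_induced[OF s s' inf f] in blast)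

theorem theorem2:
  fixes sR :: "real \<Rightarrow> 'a::real_normed_vector \<Rightarrow> 'a"
    and sR' :: "real \<Rightarrow> 'b::real_normed_vector \<Rightarrow> 'b"
    and f :: "'a set \<Rightarrow> 'b set"
    and sC :: "complex \<Rightarrow> 'c::real_normed_vector \<Rightarrow> 'c"
    and sC' :: "complex \<Rightarrow> 'd::real_normed_vector \<Rightarrow> 'd"
    and g :: "'c set \<Rightarrow> 'd set"
  shows
    "(normed_space sR \<and> normed_space sR' \<and>
      infinite_dimensional sR \<and> infinite_dimensional sR' \<and>
      bij_betw f (proj_space sR) (proj_space sR') \<longrightarrow>
        (\<exists>l. semilinear_homeomorphism sR sR' l \<and> induced_by sR f l) \<longleftrightarrow>
        PGLc_mapping sR sR' f \<and> PGLc_mapping sR' sR (inv_into (proj_space sR) f))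
   \<and> (normed_space sC \<and> normed_space sC' \<and>
      infinite_dimensional sC \<and> infinite_dimensional sC' \<and>
      bij_betw g (proj_space sC) (proj_space sC') \<longrightarrow>
        (\<exists>l. semilinear_homeomorphism sC sC' l \<and> induced_by sC g l) \<longleftrightarrow>
        PGLc_mapping sC sC' g \<and> PGLc_mapping sC' sC (inv_into (proj_space sC) g))"
  using induced_iff_PGLc[OF norming_space_real norming_space_real, of sR sR' f]
    induced_iff_PGLc[OF norming_space_complex norming_space_complex, of sC sC' g]
  by blast

end
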